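(* There exist constants $\rho_n$ ($n\ge0$) such that the following holds. Let $s,\delta>0$ be such that $1/s$ is an integer and $\delta<s/2$. Then there exists a $C^\infty$ diffeomorphism $A=A_{s,\delta}$ of $[0,1]$ such that: (1) $A=\mathrm{Id}+a$, where $a=a_{s,\delta}$ is a non-negative $C^\infty$ function of period $s$; (2) $A(0)=0$, $A(\delta)=s-\delta$, and $A(s)=s$; (3) $\delta/(2s)\le A'(x)\le 2s/\delta$ for all $x$; (4) for each $n\ge0$, $\|A\|_n\le\rho_n/\delta^{n^2}$, where $\rho_n$ does not depend on $\delta$ and $s$.
   Context: For a $C^n$ diffeomorphism $g$ of $[0,1]$, $\|g\|_n^*=\max|g^{(i)}(x)|$, the maximum over all $x\in[0,1]$ and $0\le i\le n$, and $\|g\|_n=\max\{\|g\|_n^*,\|g^{-1}\|_n^*\}$. *)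

theory Defs
  imports "HOL-Analysis.Analysis"
begin

definition smooth_fun :: "(real \<Rightarrow> real) \<Rightarrow> bool" where
  "smooth_fun f \<longleftrightarrow> (\<forall>n x. (deriv ^^ n) f differentiable (at x))"

definition diffeo01 :: "(real \<Rightarrow> real) \<Rightarrow> (real \<Rightarrow> real) \<Rightarrow> bool" where
  "diffeo01 g h \<longleftrightarrow> smooth_fun g \<and> smooth_fun h \<and>
     (\<forall>x\<in>{0..1}. g x \<in> {0..1} \<and> h (g x) = x) \<and>
     (\<forall>y\<in>{0..1}. h y \<in> {0..1} \<and> g (h y) = y)"

definition cn_star :: "nat \<Rightarrow> (real \<Rightarrow> real) \<Rightarrow> real" where
  "cn_star n g = Sup {\<bar>(deriv ^^ i) g x\<bar> | i x. i \<le> n \<and> x \<in> {0..1}}"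

definition cn_norm :: "nat \<Rightarrow> (real \<Rightarrow> real) \<Rightarrow> (real \<Rightarrow> real) \<Rightarrow> real" where
  "cn_norm n g h = max (cn_star n g) (cn_star n h)"

end

theory Submission
  imports Defs "HOL-Computational_Algebra.Polynomial"
begin

text \<open>The map is the primitive A of exp phi, where phi is a smooth s-periodic function made of three
  smoothed ramps of slope at most kap = 100 / \<delta>^2: on [0, s] it vanishes near both ends, equals
  ln tau (with tau about 2 s / \<delta>) on a plateau ending at \<delta>, and equals - ln tau on a plateau
  starting just after \<delta>. Each ramp has width O(\<delta>^2 ln (1 / \<delta>)), so the two remaining breakpoints
  can be chosen such that A \<delta> = s - \<delta> and A s = s; then A (x + s) = A x + s, and A stays above
  the identity because its slope exceeds 1 before \<delta> and is below 1 after the falling ramp.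
  Since the k-th derivative of phi is O(kap^k), that of exp phi is O(kap^k exp phi), so the
  derivative of order m + 1 of A is O(\<delta>^-(2m+1)). The derivatives of the inverse are polynomials
  in the derivatives of exp (- phi), evaluated at the inverse, hence O(\<delta>^-(3m+1)); both exponents
  are at most n^2 when m < n.\<close>

section \<open>Smooth real functions\<close>

lemma higher_deriv_Suc_inner: "(deriv ^^ Suc n) f = (deriv ^^ n) (deriv f)"
  by (simp only: funpow_Suc_right o_apply)

lemma smooth_funD: "smooth_fun f \<Longrightarrow> (deriv ^^ n) f differentiable (at x)"
  by (simp add: smooth_fun_def)

lemma smooth_fun_has_higher_deriv:
  "smooth_fun f \<Longrightarrow> ((deriv ^^ n) f has_real_derivative (deriv ^^ Suc n) f x) (at x)"
  using DERIV_deriv_iff_real_differentiable smooth_funD by simp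

lemma smooth_fun_has_deriv: "smooth_fun f \<Longrightarrow> (f has_real_derivative deriv f x) (at x)"
  using smooth_fun_has_higher_deriv[of f 0] by simp

lemma smooth_fun_deriv: "smooth_fun f \<Longrightarrow> smooth_fun (deriv f)"
  unfolding smooth_fun_def by (metis higher_deriv_Suc_inner)

lemma smooth_fun_higher_deriv: "smooth_fun f \<Longrightarrow> smooth_fun ((deriv ^^ n) f)"
  unfolding smooth_fun_def by (metis funpow_add o_apply)

lemma smooth_fun_continuous_on: "smooth_fun f \<Longrightarrow> continuous_on S f"
  by (metis DERIV_continuous continuous_at_imp_continuous_on smooth_fun_has_deriv)

lemma deriv_eqI: "(\<And>x. (f has_real_derivative f' x) (at x)) \<Longrightarrow> deriv f = f'"
  by (rule ext) (rule DERIV_imp_deriv)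

lemma smooth_funI:
  assumes f': "\<And>x. (f has_real_derivative f' x) (at x)" and "smooth_fun f'"
  shows "smooth_fun f"
  unfolding smooth_fun_def
proof (intro allI)
  fix n x
  show "(deriv ^^ n) f differentiable (at x)"
  proof (cases n)
    case 0
    then show ?thesis using f' real_differentiable_def by auto
  next
    case (Suc m)
    then show ?thesis
      using \<open>smooth_fun f'\<close> by (simp add: higher_deriv_Suc_inner deriv_eqI[OF f'] smooth_funD del: funpow.simps)
  qed
qed

lemma higher_deriv_const_real: "(deriv ^^ n) (\<lambda>x::real. c) = (\<lambda>x. if n = 0 then c else 0)"
  by (induction n arbitrary: c) (auto simp del: funpow.simps simp: higher_deriv_Suc_inner)

lemma smooth_fun_const: "smooth_fun (\<lambda>x. c)"
  by (simp add: smooth_fun_def higher_deriv_const_real)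

lemma smooth_fun_ident: "smooth_fun (\<lambda>x. x)"
  by (rule smooth_funI[OF DERIV_ident smooth_fun_const])

lemma higher_deriv_add_real:
  assumes "smooth_fun f" "smooth_fun g"
  shows "(deriv ^^ n) (\<lambda>x. f x + g x) = (\<lambda>x. (deriv ^^ n) f x + (deriv ^^ n) g x)"
  using assms
proof (induction n arbitrary: f g)
  case (Suc n)
  have "deriv (\<lambda>x. f x + g x) = (\<lambda>x. deriv f x + deriv g x)"
    by (rule deriv_eqI) (auto intro!: DERIV_add smooth_fun_has_deriv Suc.prems)
  then show ?case
    using Suc.IH[of "deriv f" "deriv g"] Suc.prems
    by (simp add: higher_deriv_Suc_inner smooth_fun_deriv del: funpow.simps)
qed simp

lemma smooth_fun_add: "smooth_fun f \<Longrightarrow> smooth_fun g \<Longrightarrow> smooth_fun (\<lambda>x. f x + g x)"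
  by (auto simp: smooth_fun_def[of "\<lambda>x. f x + g x"] higher_deriv_add_real smooth_funD)

lemma higher_deriv_cmult_real:
  assumes "smooth_fun f"
  shows "(deriv ^^ n) (\<lambda>x. c * f x) = (\<lambda>x. c * (deriv ^^ n) f x)"
  using assms
proof (induction n arbitrary: f)
  case (Suc n)
  have "deriv (\<lambda>x. c * f x) = (\<lambda>x. c * deriv f x)"
    by (rule deriv_eqI) (auto intro!: DERIV_cmult smooth_fun_has_deriv Suc.prems)
  then show ?case
    using Suc.IH[of "deriv f"] Suc.prems
    by (simp add: higher_deriv_Suc_inner smooth_fun_deriv del: funpow.simps)
qed simp

lemma smooth_fun_cmult: "smooth_fun f \<Longrightarrow> smooth_fun (\<lambda>x. c * f x)"
  by (auto simp: smooth_fun_def[of "\<lambda>x. c * f x"] higher_deriv_cmult_real smooth_funD)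

lemma higher_deriv_minus_real:
  "smooth_fun f \<Longrightarrow> (deriv ^^ n) (\<lambda>x. - f x) = (\<lambda>x. - (deriv ^^ n) f x)"
  using higher_deriv_cmult_real[of f n "-1"] by simp

lemma smooth_fun_minus: "smooth_fun f \<Longrightarrow> smooth_fun (\<lambda>x. - f x)"
  using smooth_fun_cmult[of f "-1"] by simp

lemma higher_deriv_diff_real:
  assumes "smooth_fun f" "smooth_fun g"
  shows "(deriv ^^ n) (\<lambda>x. f x - g x) = (\<lambda>x. (deriv ^^ n) f x - (deriv ^^ n) g x)"
  using higher_deriv_add_real[OF assms(1) smooth_fun_minus[OF assms(2)], of n]
    higher_deriv_minus_real[OF assms(2)] by simp

lemma smooth_fun_diff: "smooth_fun f \<Longrightarrow> smooth_fun g \<Longrightarrow> smooth_fun (\<lambda>x. f x - g x)"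
  using smooth_fun_add[of f "\<lambda>x. - g x"] smooth_fun_minus by simp

lemma higher_deriv_mult_real:
  assumes f: "smooth_fun f" and g: "smooth_fun g"
  shows "(deriv ^^ n) (\<lambda>w. f w * g w) z =
           (\<Sum>i = 0..n. of_nat (n choose i) * (deriv ^^ i) f z * (deriv ^^ (n - i)) g z)"
proof (induction n arbitrary: z)
  case (Suc n z)
  have D: "\<And>n. ((deriv ^^ n) f has_field_derivative deriv ((deriv ^^ n) f) z) (at z)"
          "\<And>n. ((deriv ^^ n) g has_field_derivative deriv ((deriv ^^ n) g) z) (at z)"
    using smooth_fun_has_higher_deriv[OF f] smooth_fun_has_higher_deriv[OF g] by auto
  have choose_Suc: "Suc m choose k = (m choose k) + (if k = 0 then 0 else m choose (k - 1))" for m k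
    by (cases k) simp_all
  have pascal: "(\<Sum>i = 0..n. of_nat (n choose i) *
        (deriv ((deriv ^^ i) f) z * (deriv ^^ (n - i)) g z + deriv ((deriv ^^ (n - i)) g) z * (deriv ^^ i) f z)) =
      g z * deriv ((deriv ^^ n) f) z +
        (\<Sum>i = 0..n. (deriv ^^ i) f z * (of_nat (Suc n choose i) * (deriv ^^ (Suc n - i)) g z))"
    apply (simp add: choose_Suc algebra_simps sum.distrib)
    apply (subst (4) sum_Suc_reindex)
    apply (auto simp: algebra_simps Suc_diff_le intro: sum.cong)
    done
  have "((deriv ^^ n) (\<lambda>w. f w * g w) has_field_derivative
         (\<Sum>i = 0..Suc n. (Suc n choose i) * (deriv ^^ i) f z * (deriv ^^ (Suc n - i)) g z)) (at z)"
    apply (rule has_field_derivative_transform_within_open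
        [of "\<lambda>w. (\<Sum>i = 0..n. of_nat (n choose i) * (deriv ^^ i) f w * (deriv ^^ (n - i)) g w)" _ _ UNIV])
       apply (simp add: algebra_simps)
       apply (rule derivative_eq_intros | simp)+
           apply (auto intro: DERIV_mult D Suc.IH [symmetric])
    by (metis (no_types, lifting) mult.commute sum.cong pascal)
  then show ?case
    unfolding funpow.simps o_apply by (simp add: DERIV_imp_deriv)
qed simp

lemma smooth_fun_mult:
  assumes f: "smooth_fun f" and g: "smooth_fun g"
  shows "smooth_fun (\<lambda>x. f x * g x)"
  unfolding smooth_fun_def
proof (intro allI)
  fix n x
  have "((\<lambda>z. \<Sum>i = 0..n. of_nat (n choose i) * (deriv ^^ i) f z * (deriv ^^ (n - i)) g z)
     has_real_derivative (\<Sum>i = 0..n. of_nat (n choose i) * ((deriv ^^ Suc i) f x * (deriv ^^ (n - i)) g x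
       + (deriv ^^ i) f x * (deriv ^^ Suc (n - i)) g x))) (at x)"
    by (auto intro!: derivative_eq_intros smooth_fun_has_higher_deriv f g simp: algebra_simps)
  moreover have "(deriv ^^ n) (\<lambda>w. f w * g w) =
      (\<lambda>z. \<Sum>i = 0..n. of_nat (n choose i) * (deriv ^^ i) f z * (deriv ^^ (n - i)) g z)"
    using higher_deriv_mult_real[OF f g] by blast
  ultimately show "(deriv ^^ n) (\<lambda>w. f w * g w) differentiable (at x)"
    using real_differentiable_def by auto
qed

lemma higher_deriv_compose_affine_real:
  assumes f: "smooth_fun f"
  shows "(deriv ^^ n) (\<lambda>x. f (a * x + b)) = (\<lambda>x. a ^ n * (deriv ^^ n) f (a * x + b))"
proof (induction n)
  case (Suc n)
  have "((\<lambda>x. a ^ n * (deriv ^^ n) f (a * x + b)) has_real_derivative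
          a ^ Suc n * (deriv ^^ Suc n) f (a * x + b)) (at x)" for x
  proof -
    have "((\<lambda>x. (deriv ^^ n) f (a * x + b)) has_real_derivative
            (deriv ^^ Suc n) f (a * x + b) * a) (at x)"
      by (rule DERIV_chain2[OF smooth_fun_has_higher_deriv[OF f]]) (auto intro!: derivative_eq_intros)
    from DERIV_cmult[OF this, of "a ^ n"] show ?thesis
      by (simp add: algebra_simps)
  qed
  then show ?case
    using Suc by (simp add: deriv_eqI)
qed simp

lemma smooth_fun_compose_affine:
  assumes f: "smooth_fun f" shows "smooth_fun (\<lambda>x. f (a * x + b))"
  unfolding smooth_fun_def higher_deriv_compose_affine_real[OF f]
proof (intro allI)
  fix n x
  have "((\<lambda>x. a ^ n * (deriv ^^ n) f (a * x + b)) has_real_derivative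
          a ^ n * ((deriv ^^ Suc n) f (a * x + b) * a)) (at x)"
    by (intro DERIV_cmult DERIV_chain2[OF smooth_fun_has_higher_deriv[OF f]])
       (auto intro!: derivative_eq_intros)
  then show "(\<lambda>x. a ^ n * (deriv ^^ n) f (a * x + b)) differentiable (at x)"
    using real_differentiable_def by blast
qed

lemma higher_deriv_eq_on_open:
  assumes "open S" "x \<in> S" "\<And>y. y \<in> S \<Longrightarrow> f y = g y"
  shows "(deriv ^^ n) f x = (deriv ^^ n) g x"
  by (rule higher_deriv_cong_ev) (use assms in \<open>auto simp: eventually_nhds\<close>)

lemma smooth_fun_local:
  assumes "\<And>x. \<exists>S h. open S \<and> x \<in> S \<and> smooth_fun h \<and> (\<forall>y\<in>S. f y = h y)"
  shows "smooth_fun f"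
  unfolding smooth_fun_def
proof (intro allI)
  fix n x
  obtain S h where S: "open S" "x \<in> S" "smooth_fun h" "\<forall>y\<in>S. f y = h y"
    using assms by blast
  have "((deriv ^^ n) f has_real_derivative (deriv ^^ Suc n) h x) (at x)"
    by (rule has_field_derivative_transform_within_open[OF smooth_fun_has_higher_deriv[OF S(3)] S(1,2)])
       (use S in \<open>auto intro!: higher_deriv_eq_on_open[symmetric]\<close>)
  then show "(deriv ^^ n) f differentiable (at x)"
    using real_differentiable_def by blast
qed

lemma smooth_fun_exp:
  assumes f: "smooth_fun f"
  shows "smooth_fun (\<lambda>x. exp (f x))"
proof -
  have "\<exists>P. smooth_fun P \<and> (deriv ^^ n) (\<lambda>x. exp (f x)) = (\<lambda>x. P x * exp (f x))" for n
  proof (induction n)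
    case 0
    then show ?case using smooth_fun_const[of 1] by auto
  next
    case (Suc n)
    then obtain P where P: "smooth_fun P" "(deriv ^^ n) (\<lambda>x. exp (f x)) = (\<lambda>x. P x * exp (f x))"
      by blast
    have "deriv (\<lambda>x. P x * exp (f x)) = (\<lambda>x. (deriv P x + P x * deriv f x) * exp (f x))"
      by (rule deriv_eqI)
         (auto intro!: derivative_eq_intros smooth_fun_has_deriv P f simp: algebra_simps)
    then show ?case
      using P by (intro exI[of _ "\<lambda>x. deriv P x + P x * deriv f x"])
         (auto intro!: smooth_fun_add smooth_fun_mult smooth_fun_deriv f)
  qed
  note exp_higher_deriv = this
  show ?thesis
    unfolding smooth_fun_def
  proof (intro allI)
    fix n x
    obtain P where P: "smooth_fun P" "(deriv ^^ n) (\<lambda>x. exp (f x)) = (\<lambda>x. P x * exp (f x))"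
      using exp_higher_deriv by blast
    have "((\<lambda>x. P x * exp (f x)) has_real_derivative
            deriv P x * exp (f x) + P x * (exp (f x) * deriv f x)) (at x)"
      by (auto intro!: derivative_eq_intros smooth_fun_has_deriv P f)
    then show "(deriv ^^ n) (\<lambda>x. exp (f x)) differentiable (at x)"
      unfolding P(2) using real_differentiable_def by blast
  qed
qed

section \<open>Antiderivatives\<close>

definition antideriv :: "(real \<Rightarrow> real) \<Rightarrow> real \<Rightarrow> real" where
  "antideriv f = (SOME F. F 0 = 0 \<and> (\<forall>x. (F has_real_derivative f x) (at x)))"

lemma antideriv:
  assumes "continuous_on UNIV f"
  shows antideriv_0: "antideriv f 0 = 0"
    and has_real_derivative_antideriv: "(antideriv f has_real_derivative f x) (at x)"
proof -
  obtain F where F: "\<And>x. (F has_real_derivative f x) (at x)"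
    using einterval_antiderivative[of "-\<infinity>" "\<infinity>" f] assms
    by (auto simp: continuous_on_eq_continuous_at has_real_derivative_iff_has_vector_derivative)
  have "((\<lambda>x. F x - F 0) has_real_derivative f x) (at x)" for x
    using F by (auto intro!: derivative_eq_intros)
  then have "\<exists>F. F 0 = 0 \<and> (\<forall>x. (F has_real_derivative f x) (at x))"
    by (intro exI[of _ "\<lambda>x. F x - F 0"]) auto
  from someI_ex[OF this] show "antideriv f 0 = 0" "(antideriv f has_real_derivative f x) (at x)"
    unfolding antideriv_def by auto
qed

lemma smooth_fun_antideriv: "smooth_fun f \<Longrightarrow> smooth_fun (antideriv f)"
  by (rule smooth_funI[OF has_real_derivative_antideriv]) (auto intro: smooth_fun_continuous_on)

lemma DERIV_increment_mono:
  assumes "a \<le> b"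
    and "\<And>x. x \<in> {a..b} \<Longrightarrow> (F has_real_derivative f x) (at x)"
    and "\<And>x. x \<in> {a..b} \<Longrightarrow> (H has_real_derivative h x) (at x)"
    and "\<And>x. x \<in> {a..b} \<Longrightarrow> f x \<le> h x"
  shows "F b - F a \<le> H b - H a"
proof -
  have "(\<lambda>x. H x - F x) a \<le> (\<lambda>x. H x - F x) b"
    by (rule deriv_nonneg_imp_mono[of a b _ "\<lambda>x. h x - f x"])
       (use assms in \<open>auto intro!: derivative_eq_intros\<close>)
  then show ?thesis by simp
qed

lemma DERIV_increment_eq:
  assumes "a \<le> b"
    and "\<And>x. x \<in> {a..b} \<Longrightarrow> (F has_real_derivative f x) (at x)"
    and "\<And>x. x \<in> {a..b} \<Longrightarrow> (H has_real_derivative f x) (at x)"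
  shows "F b - F a = H b - H a"
  using DERIV_increment_mono[OF assms(1,2,3)] DERIV_increment_mono[OF assms(1,3,2)] by auto

lemma antideriv_increment_bounds:
  assumes "continuous_on UNIV f" "a \<le> b" "\<And>y. y \<in> {a..b} \<Longrightarrow> m \<le> f y \<and> f y \<le> M"
  shows "m * (b - a) \<le> antideriv f b - antideriv f a \<and> antideriv f b - antideriv f a \<le> M * (b - a)"
proof
  have F: "\<And>x. (antideriv f has_real_derivative f x) (at x)"
    by (rule has_real_derivative_antideriv[OF assms(1)])
  have "(\<lambda>x. m * x) b - (\<lambda>x. m * x) a \<le> antideriv f b - antideriv f a"
    by (rule DERIV_increment_mono[OF assms(2) _ F]) (use assms(3) in \<open>auto intro!: derivative_eq_intros\<close>)
  then show "m * (b - a) \<le> antideriv f b - antideriv f a"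
    by (simp add: algebra_simps)
  have "antideriv f b - antideriv f a \<le> (\<lambda>x. M * x) b - (\<lambda>x. M * x) a"
    by (rule DERIV_increment_mono[OF assms(2) F]) (use assms(3) in \<open>auto intro!: derivative_eq_intros\<close>)
  then show "antideriv f b - antideriv f a \<le> M * (b - a)"
    by (simp add: algebra_simps)
qed

lemma antideriv_mono:
  assumes "continuous_on UNIV f" "\<And>y. 0 \<le> f y" "a \<le> b"
  shows "antideriv f a \<le> antideriv f b"
  by (rule deriv_nonneg_imp_mono[OF has_real_derivative_antideriv[OF assms(1)]]) (use assms in auto)

lemma antideriv_increment_const:
  assumes "continuous_on UNIV f" "a \<le> b" "\<And>y. y \<in> {a..b} \<Longrightarrow> f y = c"
  shows "antideriv f b - antideriv f a = c * (b - a)"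
  using antideriv_increment_bounds[OF assms(1,2), of c c] assms(3) by auto

lemma antideriv_increment_eq:
  assumes "continuous_on UNIV f" "a \<le> b" "\<And>y. y \<in> {a..b} \<Longrightarrow> (G has_real_derivative f y) (at y)"
  shows "antideriv f b - antideriv f a = G b - G a"
  by (rule DERIV_increment_eq[OF assms(2) has_real_derivative_antideriv[OF assms(1)] assms(3)])

lemma has_real_derivative_antideriv_shift:
  "continuous_on UNIV g \<Longrightarrow> ((\<lambda>x. antideriv g (x - p)) has_real_derivative g (y - p)) (at y)"
  using DERIV_chain2[OF has_real_derivative_antideriv DERIV_diff[OF DERIV_ident DERIV_const]] by simp

section \<open>A smooth step function and a smooth clamp\<close>

text \<open>The derivatives of the flat function exp (- 1 / x) stay in this family.\<close>

definition flat_poly :: "real poly \<Rightarrow> real \<Rightarrow> real" where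
  "flat_poly p x = (if 0 < x then poly p (inverse x) * exp (- inverse x) else 0)"

lemma poly_div_exp_tendsto_0:
  fixes p :: "real poly"
  shows "((\<lambda>t. poly p t / exp t) \<longlongrightarrow> 0) at_top"
proof -
  have "((\<lambda>t. \<Sum>i\<le>degree p. coeff p i * (t ^ i / exp t)) \<longlongrightarrow> (\<Sum>i\<le>degree p. coeff p i * 0)) at_top"
    by (intro tendsto_sum tendsto_mult tendsto_const tendsto_power_div_exp_0)
  then show ?thesis by (simp add: poly_altdef sum_divide_distrib)
qed

lemma flat_poly_DERIV:
  "(flat_poly p has_real_derivative flat_poly ([:0, 0, 1:] * (p - pderiv p)) x) (at x)"
proof (cases "0 < x")
  case True
  have d1: "((\<lambda>x. poly p (inverse x)) has_real_derivative
              poly (pderiv p) (inverse x) * (- (inverse x ^ 2))) (at x)"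
    using DERIV_chain2[OF poly_DERIV DERIV_inverse[of x UNIV]] True by (simp add: power2_eq_square)
  have d2: "((\<lambda>x. exp (- inverse x)) has_real_derivative exp (- inverse x) * (inverse x ^ 2)) (at x)"
    using DERIV_fun_exp[OF DERIV_minus[OF DERIV_inverse[of x UNIV]]] True by (simp add: power2_eq_square)
  have "((\<lambda>x. poly p (inverse x) * exp (- inverse x)) has_real_derivative
          flat_poly ([:0, 0, 1:] * (p - pderiv p)) x) (at x)"
    using DERIV_mult[OF d1 d2] True by (simp add: flat_poly_def algebra_simps power2_eq_square)
  then show ?thesis
    by (rule has_field_derivative_transform_within_open[of _ _ _ "{0<..}"])
       (use True in \<open>auto simp: flat_poly_def\<close>)
next
  case False
  show ?thesis
  proof (cases "x < 0")
    case True
    have "(flat_poly p has_real_derivative 0) (at x)"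
      by (rule has_field_derivative_transform_within_open[OF DERIV_const, of "{..<0}"])
         (use True in \<open>auto simp: flat_poly_def\<close>)
    then show ?thesis using True by (simp add: flat_poly_def)
  next
    case False
    with \<open>\<not> 0 < x\<close> have x0: "x = 0" by simp
    have "((\<lambda>y. (flat_poly p y - flat_poly p 0) / (y - 0)) \<longlongrightarrow> 0) (at 0)"
    proof (rule filterlim_split_at)
      have "eventually (\<lambda>y. 0 = (flat_poly p y - flat_poly p 0) / (y - 0)) (at_left (0::real))"
        unfolding eventually_at_left_field by (intro exI[of _ "-1"]) (auto simp: flat_poly_def)
      then show "((\<lambda>y. (flat_poly p y - flat_poly p 0) / (y - 0)) \<longlongrightarrow> 0) (at_left 0)"
        by (rule Lim_transform_eventually[OF tendsto_const])
    next
      \<comment> \<open>on the right the difference quotient is a polynomial in 1/y divided by exp(1/y)\<close>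
      have lim: "((\<lambda>y. poly (pCons 0 p) (inverse y) / exp (inverse y)) \<longlongrightarrow> 0) (at_right 0)"
        by (rule filterlim_compose[OF poly_div_exp_tendsto_0 filterlim_inverse_at_top_right])
      have "eventually (\<lambda>y. poly (pCons 0 p) (inverse y) / exp (inverse y) =
              (flat_poly p y - flat_poly p 0) / (y - 0)) (at_right (0::real))"
        unfolding eventually_at_right_field
        by (intro exI[of _ 1]) (auto simp: flat_poly_def exp_minus field_simps)
      then show "((\<lambda>y. (flat_poly p y - flat_poly p 0) / (y - 0)) \<longlongrightarrow> 0) (at_right 0)"
        by (rule Lim_transform_eventually[OF lim])
    qed
    then show ?thesis
      using x0 by (simp add: has_field_derivative_iff flat_poly_def)
  qed
qed

lemma smooth_fun_flat_poly: "smooth_fun (flat_poly p)"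
  unfolding smooth_fun_def
proof (intro allI)
  fix n x
  show "(deriv ^^ n) (flat_poly p) differentiable (at x)"
  proof (induction n arbitrary: p)
    case 0
    then show ?case using flat_poly_DERIV real_differentiable_def by auto
  next
    case (Suc n)
    then show ?case
      by (simp add: higher_deriv_Suc_inner deriv_eqI[OF flat_poly_DERIV] del: funpow.simps)
  qed
qed

definition bump :: "real \<Rightarrow> real" where
  "bump x = flat_poly 1 x * flat_poly 1 (1 - x)"

lemma smooth_fun_bump: "smooth_fun bump"
  using smooth_fun_mult[OF smooth_fun_flat_poly smooth_fun_compose_affine[OF smooth_fun_flat_poly, where a="-1" and b=1]]
  by (simp add: bump_def[abs_def])

lemma bump_nonneg: "0 \<le> bump x"
  by (simp add: bump_def flat_poly_def)

lemma bump_pos: "0 < x \<Longrightarrow> x < 1 \<Longrightarrow> 0 < bump x"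
  by (simp add: bump_def flat_poly_def)

lemma bump_eq_0: "x \<le> 0 \<or> 1 \<le> x \<Longrightarrow> bump x = 0"
  by (auto simp: bump_def flat_poly_def)

lemma continuous_on_bump: "continuous_on UNIV bump"
  by (rule smooth_fun_continuous_on[OF smooth_fun_bump])

lemma antideriv_bump_1_pos: "0 < antideriv bump 1"
proof -
  obtain z where "0 < z" "z < 1" "antideriv bump 1 - antideriv bump 0 = (1 - 0) * bump z"
    using MVT2[of 0 1 "antideriv bump" bump] has_real_derivative_antideriv[OF continuous_on_bump]
    by auto
  then show ?thesis
    using bump_pos[of z] antideriv_0[OF continuous_on_bump] by simp
qed

definition smooth_step :: "real \<Rightarrow> real" where
  "smooth_step x = antideriv bump x / antideriv bump 1"

lemma smooth_fun_smooth_step: "smooth_fun smooth_step"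
  using smooth_fun_cmult[OF smooth_fun_antideriv[OF smooth_fun_bump], of "inverse (antideriv bump 1)"]
  by (simp add: smooth_step_def[abs_def] divide_inverse mult.commute)

lemma continuous_on_smooth_step: "continuous_on UNIV smooth_step"
  by (rule smooth_fun_continuous_on[OF smooth_fun_smooth_step])

lemma smooth_step_eq_0: "x \<le> 0 \<Longrightarrow> smooth_step x = 0"
  using antideriv_increment_const[OF continuous_on_bump, of x 0 0] bump_eq_0
    antideriv_0[OF continuous_on_bump]
  by (simp add: smooth_step_def)

lemma smooth_step_eq_1: "1 \<le> x \<Longrightarrow> smooth_step x = 1"
  using antideriv_increment_const[OF continuous_on_bump, of 1 x 0] bump_eq_0 antideriv_bump_1_pos
  by (simp add: smooth_step_def)

lemma smooth_step_bounds: "0 \<le> smooth_step x \<and> smooth_step x \<le> 1"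
proof -
  have "antideriv bump 0 \<le> antideriv bump (min (max x 0) 1)"
    and "antideriv bump (min (max x 0) 1) \<le> antideriv bump 1"
    by (auto intro!: antideriv_mono continuous_on_bump bump_nonneg)
  moreover have "smooth_step x = smooth_step (min (max x 0) 1)"
    using smooth_step_eq_0 smooth_step_eq_1 by (cases "x \<le> 0"; cases "1 \<le> x") auto
  ultimately show ?thesis
    using antideriv_bump_1_pos antideriv_0[OF continuous_on_bump]
    by (simp add: smooth_step_def)
qed

lemma bdd_above_higher_deriv_smooth_step:
  "bdd_above (range (\<lambda>u. \<bar>(deriv ^^ i) smooth_step u\<bar>))"
proof -
  have "compact ((deriv ^^ i) smooth_step ` {0..1})"
    by (intro compact_continuous_image smooth_fun_continuous_on smooth_fun_higher_deriv
        smooth_fun_smooth_step) auto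
  then obtain B where B: "\<forall>y \<in> (deriv ^^ i) smooth_step ` {0..1}. norm y \<le> B"
    using compact_imp_bounded bounded_iff by metis
  have outside: "\<bar>(deriv ^^ i) smooth_step u\<bar> \<le> 1" if "u \<notin> {0..1}" for u
  proof (cases "u < 0")
    case True
    have "(deriv ^^ i) smooth_step u = (deriv ^^ i) (\<lambda>_. 0) u"
      by (rule higher_deriv_eq_on_open[of "{..<0}"]) (use True in \<open>auto simp: smooth_step_eq_0\<close>)
    then show ?thesis by (simp add: higher_deriv_const_real)
  next
    case False
    with that have "1 < u" by auto
    have "(deriv ^^ i) smooth_step u = (deriv ^^ i) (\<lambda>_. 1) u"
      by (rule higher_deriv_eq_on_open[of "{1<..}"]) (use \<open>1 < u\<close> in \<open>auto simp: smooth_step_eq_1\<close>)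
    then show ?thesis by (simp add: higher_deriv_const_real)
  qed
  have "\<bar>(deriv ^^ i) smooth_step u\<bar> \<le> max B 1" for u
    using B outside[of u] by (cases "u \<in> {0..1}") force+
  then show ?thesis by (intro bdd_aboveI2)
qed

definition step_deriv_bound :: "nat \<Rightarrow> real" where
  "step_deriv_bound i = (SUP u. \<bar>(deriv ^^ i) smooth_step u\<bar>)"

lemma abs_higher_deriv_smooth_step_le: "\<bar>(deriv ^^ i) smooth_step u\<bar> \<le> step_deriv_bound i"
  unfolding step_deriv_bound_def by (rule cSUP_upper[OF _ bdd_above_higher_deriv_smooth_step]) simp

definition smooth_pos_part :: "real \<Rightarrow> real" where
  "smooth_pos_part = antideriv smooth_step"

lemma smooth_fun_smooth_pos_part: "smooth_fun smooth_pos_part"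
  unfolding smooth_pos_part_def by (rule smooth_fun_antideriv[OF smooth_fun_smooth_step])

lemma smooth_pos_part_eq_0: "x \<le> 0 \<Longrightarrow> smooth_pos_part x = 0"
  using antideriv_increment_const[OF continuous_on_smooth_step, of x 0 0] smooth_step_eq_0
    antideriv_0[OF continuous_on_smooth_step]
  by (simp add: smooth_pos_part_def)

lemma smooth_pos_part_right: "1 \<le> x \<Longrightarrow> smooth_pos_part x = smooth_pos_part 1 + (x - 1)"
  using antideriv_increment_const[OF continuous_on_smooth_step, of 1 x 1] smooth_step_eq_1
  by (simp add: smooth_pos_part_def)

lemma smooth_pos_part_increment:
  "b \<le> a \<Longrightarrow> 0 \<le> smooth_pos_part a - smooth_pos_part b \<and> smooth_pos_part a - smooth_pos_part b \<le> a - b"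
  using antideriv_increment_bounds[OF continuous_on_smooth_step, of b a 0 1] smooth_step_bounds
  by (simp add: smooth_pos_part_def)

lemma smooth_pos_part_ge: "u - 1 \<le> smooth_pos_part u"
proof (cases "1 \<le> u")
  case True
  then show ?thesis
    using smooth_pos_part_right[of u] smooth_pos_part_increment[of 0 1] smooth_pos_part_eq_0[of 0]
    by simp
next
  case False
  then show ?thesis
    using smooth_pos_part_increment[of 0 u] smooth_pos_part_eq_0[of u] smooth_pos_part_eq_0[of 0]
    by (cases "0 \<le> u") auto
qed

lemma smooth_pos_part_le: "0 \<le> u \<Longrightarrow> smooth_pos_part u \<le> u"
  using smooth_pos_part_increment[of 0 u] smooth_pos_part_eq_0[of 0] by simp

lemma abs_higher_deriv_smooth_pos_part_affine_le:
  "\<bar>(deriv ^^ Suc i) (\<lambda>x. smooth_pos_part (a * x + b)) x\<bar> \<le> \<bar>a\<bar> ^ Suc i * step_deriv_bound i"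
proof -
  have "deriv smooth_pos_part = smooth_step"
    unfolding smooth_pos_part_def
    by (rule deriv_eqI[OF has_real_derivative_antideriv[OF continuous_on_smooth_step]])
  then have "(deriv ^^ Suc i) (\<lambda>x. smooth_pos_part (a * x + b)) x =
      a ^ Suc i * (deriv ^^ i) smooth_step (a * x + b)"
    by (simp only: higher_deriv_compose_affine_real[OF smooth_fun_smooth_pos_part] higher_deriv_Suc_inner)
  then show ?thesis
    using abs_higher_deriv_smooth_step_le[of i "a * x + b"]
    by (simp add: abs_mult power_abs mult_left_mono)
qed

definition smooth_clamp :: "real \<Rightarrow> real \<Rightarrow> real" where
  "smooth_clamp M u = smooth_pos_part u - smooth_pos_part (u - M)"

lemma smooth_clamp_eq_0: "u \<le> 0 \<Longrightarrow> 0 \<le> M \<Longrightarrow> smooth_clamp M u = 0"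
  by (simp add: smooth_clamp_def smooth_pos_part_eq_0)

lemma smooth_clamp_eq_top: "0 \<le> M \<Longrightarrow> M + 1 \<le> u \<Longrightarrow> smooth_clamp M u = M"
  using smooth_pos_part_right[of u] smooth_pos_part_right[of "u - M"] by (simp add: smooth_clamp_def)

lemma smooth_clamp_bounds: "0 \<le> M \<Longrightarrow> 0 \<le> smooth_clamp M u \<and> smooth_clamp M u \<le> M"
  using smooth_pos_part_increment[of "u - M" u] by (simp add: smooth_clamp_def)

lemma smooth_clamp_ge: "0 \<le> M \<Longrightarrow> u \<le> M + 1 \<Longrightarrow> u - 2 \<le> smooth_clamp M u"
  using smooth_pos_part_ge[of u] smooth_pos_part_le[of "u - M"] smooth_pos_part_eq_0[of "u - M"]
  by (cases "u \<le> M") (auto simp: smooth_clamp_def)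

lemma smooth_fun_smooth_clamp_affine: "smooth_fun (\<lambda>x. smooth_clamp M (a * x + b))"
  unfolding smooth_clamp_def
  using smooth_fun_diff[OF smooth_fun_compose_affine[OF smooth_fun_smooth_pos_part, of a b]
      smooth_fun_compose_affine[OF smooth_fun_smooth_pos_part, of a "b - M"]]
  by (simp add: algebra_simps)

lemma abs_higher_deriv_smooth_clamp_affine_le:
  "\<bar>(deriv ^^ Suc i) (\<lambda>x. smooth_clamp M (a * x + b)) x\<bar> \<le> 2 * \<bar>a\<bar> ^ Suc i * step_deriv_bound i"
proof -
  have "(\<lambda>x. smooth_clamp M (a * x + b)) =
      (\<lambda>x. smooth_pos_part (a * x + b) - smooth_pos_part (a * x + (b - M)))"
    by (simp add: smooth_clamp_def algebra_simps)
  then have "(deriv ^^ Suc i) (\<lambda>x. smooth_clamp M (a * x + b)) x =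
      (deriv ^^ Suc i) (\<lambda>x. smooth_pos_part (a * x + b)) x -
      (deriv ^^ Suc i) (\<lambda>x. smooth_pos_part (a * x + (b - M))) x"
    by (simp only: higher_deriv_diff_real smooth_fun_compose_affine smooth_fun_smooth_pos_part)
  then show ?thesis
    using abs_higher_deriv_smooth_pos_part_affine_le[of i a b x]
      abs_higher_deriv_smooth_pos_part_affine_le[of i a "b - M" x]
    by linarith
qed

lemma step_deriv_bound_nonneg: "0 \<le> step_deriv_bound i"
  using abs_higher_deriv_smooth_step_le[of i 0] by linarith

section \<open>Derivative bounds for exponentials and for inverse functions\<close>

lemma abs_mult_le: "\<bar>a\<bar> \<le> (A::real) \<Longrightarrow> \<bar>b\<bar> \<le> B \<Longrightarrow> \<bar>a * b\<bar> \<le> A * B"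
  by (simp add: abs_mult mult_mono')

lemma abs_sum_binomial_le:
  "(\<And>i. i \<in> {0..m} \<Longrightarrow> \<bar>X i\<bar> \<le> (B i :: real)) \<Longrightarrow>
     \<bar>\<Sum>i = 0..m. real (m choose i) * X i\<bar> \<le> (\<Sum>i = 0..m. real (m choose i) * B i)"
  by (rule order_trans[OF sum_abs sum_mono]) (simp add: abs_mult mult_left_mono)

fun exp_deriv_const :: "(nat \<Rightarrow> real) \<Rightarrow> nat \<Rightarrow> real" where
  "exp_deriv_const D 0 = 1"
| "exp_deriv_const D (Suc m) =
     (\<Sum>i = 0..m. real (m choose i) * D i * exp_deriv_const D (m - i))"

lemma abs_higher_deriv_exp_le:
  assumes \<phi>: "smooth_fun \<phi>" and "0 \<le> K"
    and D: "\<And>i y. \<bar>(deriv ^^ Suc i) \<phi> y\<bar> \<le> D i * K ^ Suc i"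
  shows "\<bar>(deriv ^^ j) (\<lambda>x. exp (\<phi> x)) x\<bar> \<le> exp_deriv_const D j * K ^ j * exp (\<phi> x)"
proof (induction j arbitrary: x rule: less_induct)
  case (less j)
  show ?case
  proof (cases j)
    case 0
    then show ?thesis by simp
  next
    case (Suc m)
    have "deriv (\<lambda>x. exp (\<phi> x)) = (\<lambda>x. deriv \<phi> x * exp (\<phi> x))"
      by (rule deriv_eqI) (use DERIV_fun_exp[OF smooth_fun_has_deriv[OF \<phi>]] in \<open>simp add: mult.commute\<close>)
    then have "(deriv ^^ j) (\<lambda>x. exp (\<phi> x)) x = (deriv ^^ m) (\<lambda>x. deriv \<phi> x * exp (\<phi> x)) x"
      using Suc by (simp only: higher_deriv_Suc_inner)
    also have "\<dots> = (\<Sum>i = 0..m. real (m choose i) *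
                      ((deriv ^^ Suc i) \<phi> x * (deriv ^^ (m - i)) (\<lambda>x. exp (\<phi> x)) x))"
      by (subst higher_deriv_mult_real[OF smooth_fun_deriv[OF \<phi>] smooth_fun_exp[OF \<phi>]])
         (simp add: higher_deriv_Suc_inner mult.assoc del: funpow.simps)
    finally have eq: "(deriv ^^ j) (\<lambda>x. exp (\<phi> x)) x = (\<Sum>i = 0..m. real (m choose i) *
                      ((deriv ^^ Suc i) \<phi> x * (deriv ^^ (m - i)) (\<lambda>x. exp (\<phi> x)) x))" .
    have "\<bar>(deriv ^^ j) (\<lambda>x. exp (\<phi> x)) x\<bar> \<le> (\<Sum>i = 0..m. real (m choose i) *
                          (D i * exp_deriv_const D (m - i) * (K ^ j * exp (\<phi> x))))"
      unfolding eq
    proof (rule abs_sum_binomial_le)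
      fix i assume i: "i \<in> {0..m}"
      have "\<bar>(deriv ^^ Suc i) \<phi> x * (deriv ^^ (m - i)) (\<lambda>x. exp (\<phi> x)) x\<bar>
          \<le> (D i * K ^ Suc i) * (exp_deriv_const D (m - i) * K ^ (m - i) * exp (\<phi> x))"
        by (rule abs_mult_le[OF D less]) (use Suc in auto)
      also have "\<dots> = D i * exp_deriv_const D (m - i) * ((K ^ Suc i * K ^ (m - i)) * exp (\<phi> x))"
        by (simp add: algebra_simps)
      also have "K ^ Suc i * K ^ (m - i) = K ^ j"
        using i Suc by (simp flip: power_add)
      finally show "\<bar>(deriv ^^ Suc i) \<phi> x * (deriv ^^ (m - i)) (\<lambda>x. exp (\<phi> x)) x\<bar>
          \<le> D i * exp_deriv_const D (m - i) * (K ^ j * exp (\<phi> x))" .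
    qed
    also have "\<dots> = exp_deriv_const D j * K ^ j * exp (\<phi> x)"
      using Suc by (simp add: sum_distrib_right mult.assoc)
    finally show ?thesis .
  qed
qed


fun inverse_deriv_aux :: "(real \<Rightarrow> real) \<Rightarrow> nat \<Rightarrow> real \<Rightarrow> real" where
  "inverse_deriv_aux V 0 = V"
| "inverse_deriv_aux V (Suc n) = (\<lambda>x. deriv (inverse_deriv_aux V n) x * V x)"

fun inverse_deriv_const :: "(nat \<Rightarrow> real) \<Rightarrow> nat \<Rightarrow> nat \<Rightarrow> real" where
  "inverse_deriv_const C 0 j = C j"
| "inverse_deriv_const C (Suc n) j =
     (\<Sum>i = 0..j. real (j choose i) * (inverse_deriv_const C n (Suc i) * C (j - i)))"

lemma smooth_fun_inverse_deriv_aux: "smooth_fun V \<Longrightarrow> smooth_fun (inverse_deriv_aux V n)"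
  by (induction n) (auto intro!: smooth_fun_mult smooth_fun_deriv)

lemma abs_higher_deriv_inverse_deriv_aux_le:
  assumes V: "smooth_fun V" and C: "\<And>j x. \<bar>(deriv ^^ j) V x\<bar> \<le> C j * K ^ j * V x"
  shows "\<bar>(deriv ^^ j) (inverse_deriv_aux V n) x\<bar> \<le> inverse_deriv_const C n j * K ^ (n + j) * V x ^ Suc n"
proof (induction n arbitrary: j x)
  case 0
  then show ?case using C by simp
next
  case (Suc n)
  have eq: "(deriv ^^ j) (inverse_deriv_aux V (Suc n)) x =
      (\<Sum>i = 0..j. real (j choose i) * ((deriv ^^ Suc i) (inverse_deriv_aux V n) x * (deriv ^^ (j - i)) V x))"
    by (simp only: inverse_deriv_aux.simps,
        subst higher_deriv_mult_real[OF smooth_fun_deriv[OF smooth_fun_inverse_deriv_aux[OF V]] V])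
       (simp add: higher_deriv_Suc_inner mult.assoc del: funpow.simps)
  have "\<bar>(deriv ^^ j) (inverse_deriv_aux V (Suc n)) x\<bar> \<le> (\<Sum>i = 0..j. real (j choose i) *
           (inverse_deriv_const C n (Suc i) * C (j - i) * (K ^ (Suc n + j) * V x ^ Suc (Suc n))))"
    unfolding eq
  proof (rule abs_sum_binomial_le)
    fix i assume i: "i \<in> {0..j}"
    have "\<bar>(deriv ^^ Suc i) (inverse_deriv_aux V n) x * (deriv ^^ (j - i)) V x\<bar>
        \<le> (inverse_deriv_const C n (Suc i) * K ^ (n + Suc i) * V x ^ Suc n) * (C (j - i) * K ^ (j - i) * V x)"
      by (rule abs_mult_le[OF Suc.IH C])
    also have "\<dots> = inverse_deriv_const C n (Suc i) * C (j - i) *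
                     ((K ^ (n + Suc i) * K ^ (j - i)) * (V x ^ Suc n * V x))"
      by (simp add: algebra_simps)
    also have "K ^ (n + Suc i) * K ^ (j - i) = K ^ (Suc n + j)"
      using i by (simp flip: power_add)
    also have "V x ^ Suc n * V x = V x ^ Suc (Suc n)"
      by (simp add: mult.commute)
    finally show "\<bar>(deriv ^^ Suc i) (inverse_deriv_aux V n) x * (deriv ^^ (j - i)) V x\<bar>
        \<le> inverse_deriv_const C n (Suc i) * C (j - i) * (K ^ (Suc n + j) * V x ^ Suc (Suc n))" .
  qed
  also have "\<dots> = inverse_deriv_const C (Suc n) j * K ^ (Suc n + j) * V x ^ Suc (Suc n)"
    by (simp add: sum_distrib_right mult.assoc)
  finally show ?case .
qed

lemma higher_deriv_inverse_function:
  fixes A g E V :: "real \<Rightarrow> real"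
  assumes A: "\<And>x. (A has_real_derivative E x) (at x)" and E: "\<And>x. 0 < E x"
    and V: "smooth_fun V" "\<And>x. V x * E x = 1"
    and g: "\<And>x. g (A x) = x" "\<And>y. A (g y) = y"
  shows "(deriv ^^ Suc n) g = (\<lambda>y. inverse_deriv_aux V n (g y))" and "smooth_fun g"
proof -
  have cont: "isCont g y" for y
    using isCont_inverse_function[where f=A and g=g and x="g y" and d=1] g DERIV_isCont[OF A]
    by auto
  have "(g has_real_derivative inverse (E (g y))) (at y)" for y
    by (rule DERIV_inverse_function[where f=A and a="y - 1" and b="y + 1"])
       (use A E g cont in \<open>auto simp: less_imp_neq[symmetric]\<close>)
  moreover have "inverse (E x) = V x" for x
    using V(2)[of x] E[of x] by (simp add: field_simps)
  ultimately have g': "(g has_real_derivative V (g y)) (at y)" for y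
    by simp
  have Q': "((\<lambda>y. inverse_deriv_aux V n (g y)) has_real_derivative
              inverse_deriv_aux V (Suc n) (g y)) (at y)" for n y
    using DERIV_chain2[OF smooth_fun_has_deriv[OF smooth_fun_inverse_deriv_aux[OF V(1)]] g'] by simp
  show formula: "(deriv ^^ Suc n) g = (\<lambda>y. inverse_deriv_aux V n (g y))" for n
  proof (induction n)
    case 0
    then show ?case by (simp add: deriv_eqI[OF g'])
  next
    case (Suc n)
    have "(deriv ^^ Suc (Suc n)) g = deriv (\<lambda>y. inverse_deriv_aux V n (g y))"
      using Suc by simp
    then show ?case
      by (simp only: deriv_eqI[OF Q'])
  qed
  show "smooth_fun g"
    unfolding smooth_fun_def
  proof (intro allI)
    fix n y
    show "(deriv ^^ n) g differentiable (at y)"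
    proof (cases n)
      case 0
      then show ?thesis using g' real_differentiable_def by auto
    next
      case (Suc m)
      then show ?thesis using Q'[of m y] real_differentiable_def by (auto simp only: formula)
    qed
  qed
qed

lemma exp_deriv_const_nonneg: "(\<And>i. 0 \<le> D i) \<Longrightarrow> 0 \<le> exp_deriv_const D j"
  by (induction D j rule: exp_deriv_const.induct) (auto intro!: sum_nonneg)

lemma inverse_deriv_const_nonneg: "(\<And>j. 0 \<le> C j) \<Longrightarrow> 0 \<le> inverse_deriv_const C n j"
  by (induction C n j rule: inverse_deriv_const.induct) (auto intro!: sum_nonneg)

section \<open>The construction\<close>

lemma cn_star_le:
  assumes "\<And>i x. i \<le> n \<Longrightarrow> x \<in> {0..1} \<Longrightarrow> \<bar>(deriv ^^ i) g x\<bar> \<le> B"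
  shows "cn_star n g \<le> B"
  unfolding cn_star_def by (rule cSup_least) (use assms in force)+

definition slope_deriv_const :: "nat \<Rightarrow> real" where
  "slope_deriv_const = exp_deriv_const (\<lambda>i. 6 * step_deriv_bound i)"

definition norm_const :: "nat \<Rightarrow> real" where
  "norm_const n = 1 + (\<Sum>m<n. 2 * 100 ^ m * slope_deriv_const m
     + 2 ^ Suc m * 100 ^ m * inverse_deriv_const slope_deriv_const m 0)"

lemma slope_deriv_const_nonneg: "0 \<le> slope_deriv_const j"
  unfolding slope_deriv_const_def by (intro exp_deriv_const_nonneg) (simp add: step_deriv_bound_nonneg)

lemma norm_const_ge:
  "1 \<le> norm_const n"
  "m < n \<Longrightarrow> 2 * 100 ^ m * slope_deriv_const m \<le> norm_const n"
  "m < n \<Longrightarrow> 2 ^ Suc m * 100 ^ m * inverse_deriv_const slope_deriv_const m 0 \<le> norm_const n"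
proof -
  define t where "t m = 2 * 100 ^ m * slope_deriv_const m
     + 2 ^ Suc m * 100 ^ m * inverse_deriv_const slope_deriv_const m 0" for m
  have t: "0 \<le> 2 * 100 ^ m * slope_deriv_const m"
    "0 \<le> 2 ^ Suc m * 100 ^ m * inverse_deriv_const slope_deriv_const m 0" for m
    by (simp_all add: slope_deriv_const_nonneg inverse_deriv_const_nonneg)
  then have "0 \<le> t m" for m
    by (simp add: t_def)
  then have "0 \<le> sum t {..<n}" "m < n \<Longrightarrow> t m \<le> sum t {..<n}"
    by (auto intro: sum_nonneg member_le_sum)
  moreover have "norm_const n = 1 + sum t {..<n}"
    unfolding norm_const_def t_def ..
  ultimately show "1 \<le> norm_const n"
    "m < n \<Longrightarrow> 2 * 100 ^ m * slope_deriv_const m \<le> norm_const n"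
    "m < n \<Longrightarrow> 2 ^ Suc m * 100 ^ m * inverse_deriv_const slope_deriv_const m 0 \<le> norm_const n"
    using t[of m] unfolding t_def by linarith+
qed

locale push_construction =
  fixes s \<delta> :: real
  assumes delta_pos: "0 < \<delta>" and two_delta_less: "2 * \<delta> < s" and s_le_1: "s \<le> 1"
begin

definition "nu = s - 2 * \<delta>"
definition "tau = (2 * s - 3 * \<delta>) / \<delta>"
definition "L = ln tau"
definition "kap = 100 / \<delta>\<^sup>2"
definition "W = (L + 1) / kap"
definition "W2 = (2 * L + 1) / kap"

definition rise :: "real \<Rightarrow> real" where
  "rise y = exp (smooth_clamp L (kap * y))"

definition fall :: "real \<Rightarrow> real" where
  "fall y = exp (L - smooth_clamp (2 * L) (kap * y))"

text \<open>X1, X2 and X3 are the amounts by which the primitive of exp phi gains on the identity across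
  the three ramps of phi; the breakpoints p1 and p3 are the solutions of the linear equations
  A \<delta> = s - \<delta> and A s = s.\<close>

definition "X1 = antideriv rise W - W"
definition "X2 = antideriv fall W2 - W2"
definition "X3 = antideriv rise W / tau - W"

definition "p1 = \<delta> - W - (nu - X1) / (tau - 1)"
definition "Z = (nu + X2 + X3) * tau / (tau - 1)"
definition "p3 = \<delta> + W2 + Z"

definition phi :: "real \<Rightarrow> real" where
  "phi x = smooth_clamp L (kap * (x - p1)) - smooth_clamp (2 * L) (kap * (x - \<delta>))
     + smooth_clamp L (kap * (x - p3))"

lemma s_pos: "0 < s"
  using delta_pos two_delta_less by simp

lemma delta_le_1: "\<delta> \<le> 1"
  using two_delta_less s_le_1 delta_pos by simp

lemma nu_pos: "0 < nu"
  using two_delta_less by (simp add: nu_def)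

lemma tau_minus_1: "tau - 1 = 2 * nu / \<delta>"
  using delta_pos by (simp add: tau_def nu_def field_simps)

lemma tau_gt_1: "1 < tau"
proof -
  have "0 < 2 * nu / \<delta>"
    using nu_pos delta_pos by simp
  then show ?thesis
    using tau_minus_1 by simp
qed

lemma tau_pos: "0 < tau"
  using tau_gt_1 by simp

lemma tau_le: "tau \<le> 2 * s / \<delta>"
  using delta_pos by (simp add: tau_def divide_right_mono)

lemma tau_le_2_div_delta: "tau \<le> 2 / \<delta>"
  using tau_le divide_right_mono[of "2 * s" 2 \<delta>] s_le_1 delta_pos by simp

lemma delta_div_2s_le_inverse_tau: "\<delta> / (2 * s) \<le> 1 / tau"
proof -
  have "\<delta> / (2 * s) \<le> \<delta> / (2 * s - 3 * \<delta>)"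
    by (rule divide_left_mono) (use delta_pos two_delta_less in auto)
  then show ?thesis
    using delta_pos by (simp add: tau_def)
qed

lemma one_minus_inverse_tau_le: "1 - 1 / tau \<le> tau - 1"
proof -
  have "(tau - 1) / tau \<le> (tau - 1) / 1"
    using tau_gt_1 by (intro divide_left_mono) auto
  then show ?thesis
    using tau_pos by (simp add: diff_divide_distrib)
qed

lemma exp_L: "exp L = tau"
  using tau_pos by (simp add: L_def)

lemma exp_minus_L: "exp (- L) = 1 / tau"
  by (simp add: exp_minus exp_L inverse_eq_divide)

lemma L_pos: "0 < L"
  using tau_gt_1 by (simp add: L_def)

lemma L_times_delta_le: "L * \<delta> \<le> 2"
proof -
  have "L \<le> 2 / \<delta>"
    using ln_le_minus_one[OF tau_pos] tau_le_2_div_delta by (simp add: L_def)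
  then show ?thesis
    using delta_pos by (simp add: field_simps)
qed

lemma kap_pos: "0 < kap"
  using delta_pos by (simp add: kap_def)

lemma W_pos: "0 < W" "0 < W2"
  using L_pos kap_pos by (auto simp: W_def W2_def)

lemma W_le: "W \<le> 3 * \<delta> / 100" "W2 \<le> 5 * \<delta> / 100"
proof -
  have "(L + 1) * \<delta> \<le> 3" "(2 * L + 1) * \<delta> \<le> 5"
    using L_times_delta_le delta_le_1 by (simp_all add: algebra_simps)
  then have "(L + 1) * \<delta> * \<delta> \<le> 3 * \<delta>" "(2 * L + 1) * \<delta> * \<delta> \<le> 5 * \<delta>"
    using delta_pos by (simp_all add: mult_right_mono)
  moreover have "W = (L + 1) * \<delta> * \<delta> / 100" "W2 = (2 * L + 1) * \<delta> * \<delta> / 100"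
    by (simp_all add: W_def W2_def kap_def power2_eq_square)
  ultimately show "W \<le> 3 * \<delta> / 100" "W2 \<le> 5 * \<delta> / 100"
    by simp_all
qed

lemma smooth_clamp_shift_eq_0: "x \<le> p \<Longrightarrow> 0 \<le> M \<Longrightarrow> smooth_clamp M (kap * (x - p)) = 0"
  using kap_pos by (simp add: smooth_clamp_eq_0 mult_nonneg_nonpos)

lemma smooth_clamp_shift_eq_top:
  assumes "0 \<le> M" "p + (M + 1) / kap \<le> x"
  shows "smooth_clamp M (kap * (x - p)) = M"
proof (rule smooth_clamp_eq_top[OF assms(1)])
  show "M + 1 \<le> kap * (x - p)"
    using assms(2) kap_pos by (simp add: field_simps)
qed

lemma continuous_on_rise: "continuous_on UNIV rise"
  unfolding rise_def
  by (intro smooth_fun_continuous_on smooth_fun_exp)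
     (use smooth_fun_smooth_clamp_affine[of L kap 0] in simp)

lemma continuous_on_fall: "continuous_on UNIV fall"
  unfolding fall_def
  by (intro smooth_fun_continuous_on smooth_fun_exp smooth_fun_diff smooth_fun_const)
     (use smooth_fun_smooth_clamp_affine[of "2 * L" kap 0] in simp)

lemma rise_bounds: "1 \<le> rise y \<and> rise y \<le> tau"
  using smooth_clamp_bounds[of L "kap * y"] L_pos
  unfolding rise_def exp_L[symmetric] by simp

lemma fall_bounds: "1 / tau \<le> fall y \<and> fall y \<le> tau"
proof -
  have "exp (- L) \<le> fall y \<and> fall y \<le> exp L"
    using smooth_clamp_bounds[of "2 * L" "kap * y"] L_pos by (simp add: fall_def)
  then show ?thesis
    by (simp only: exp_L exp_minus_L)
qed

lemma X1_bounds: "0 \<le> X1 \<and> X1 \<le> (tau - 1) * W"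
  using antideriv_increment_bounds[OF continuous_on_rise, of 0 W 1 tau] rise_bounds W_pos
    antideriv_0[OF continuous_on_rise]
  by (simp add: X1_def algebra_simps)

lemma X2_bounds: "(1 / tau - 1) * W2 \<le> X2 \<and> X2 \<le> (tau - 1) * W2"
  using antideriv_increment_bounds[OF continuous_on_fall, of 0 W2 "1 / tau" tau] fall_bounds W_pos
    antideriv_0[OF continuous_on_fall]
  by (simp add: X2_def algebra_simps)

lemma X3_bounds: "(1 / tau - 1) * W \<le> X3 \<and> X3 \<le> 0"
proof -
  have "W \<le> antideriv rise W \<and> antideriv rise W \<le> tau * W"
    using antideriv_increment_bounds[OF continuous_on_rise, of 0 W 1 tau] rise_bounds W_pos
      antideriv_0[OF continuous_on_rise]
    by simp
  then show ?thesis
    using tau_pos by (simp add: X3_def field_simps)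
qed

lemma fall_le: "0 \<le> y \<Longrightarrow> y \<le> W2 \<Longrightarrow> fall y \<le> 1 + (tau - 1) * exp (2 - kap * y)"
proof -
  assume y: "0 \<le> y" "y \<le> W2"
  define z where "z = exp (2 - kap * y)"
  have "kap * y \<le> 2 * L + 1"
    using y kap_pos mult_left_mono[OF y(2), of kap] by (simp add: W2_def)
  then have "kap * y - 2 \<le> smooth_clamp (2 * L) (kap * y)"
    using smooth_clamp_ge L_pos by simp
  then have "fall y \<le> exp (L + (2 - kap * y))"
    by (simp add: fall_def)
  also have "\<dots> = tau * z"
    by (simp add: exp_add exp_L z_def)
  finally have "fall y \<le> tau * z" .
  moreover have "fall y \<le> tau"
    using fall_bounds by simp
  moreover have "0 < z"
    by (simp add: z_def)
  moreover have "tau * z = (tau - 1) * z + z"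
    by (simp add: algebra_simps)
  moreover have "(tau - 1) * 1 \<le> (tau - 1) * z" if "1 \<le> z"
    using that tau_gt_1 by (intro mult_left_mono) auto
  ultimately show ?thesis
    unfolding z_def[symmetric] by (cases "z \<le> 1") auto
qed

lemma X2_le: "X2 \<le> 9 * (tau - 1) / kap"
proof -
  define H where "H y = y - (tau - 1) * exp (2 - kap * y) / kap" for y
  have H': "(H has_real_derivative 1 + (tau - 1) * exp (2 - kap * y)) (at y)" for y
    unfolding H_def[abs_def] using kap_pos
    by (auto intro!: derivative_eq_intros simp: field_simps)
  have "antideriv fall W2 - antideriv fall 0 \<le> H W2 - H 0"
    by (rule DERIV_increment_mono[OF _ has_real_derivative_antideriv[OF continuous_on_fall] H'])
       (use W_pos fall_le in auto)
  also have "\<dots> \<le> W2 + (tau - 1) * exp 2 / kap"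
    using tau_gt_1 kap_pos by (simp add: H_def)
  also have "\<dots> \<le> W2 + (tau - 1) * 9 / kap"
  proof -
    have "exp (2::real) = exp 1 * exp 1"
      by (simp flip: exp_add)
    also have "\<dots> \<le> 3 * 3"
      using exp_le by (intro mult_mono) auto
    finally have "(tau - 1) * exp 2 \<le> (tau - 1) * 9"
      using tau_gt_1 by (intro mult_left_mono) auto
    then show ?thesis
      using divide_right_mono[of _ _ kap] kap_pos by simp
  qed
  finally show ?thesis
    using antideriv_0[OF continuous_on_fall] by (simp add: X2_def algebra_simps)
qed

lemma breakpoints_ordered: "0 < p1" "p1 + W \<le> \<delta>" "\<delta> + W2 \<le> p3" "p3 + W < s"
proof -
  have tau1: "0 < tau - 1"
    using tau_gt_1 by simp
  have "(nu - X1) / (tau - 1) \<le> nu / (tau - 1)"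
    using X1_bounds tau1 by (simp add: divide_right_mono)
  also have "\<dots> = \<delta> / 2"
    unfolding tau_minus_1 using nu_pos delta_pos by simp
  finally have "(nu - X1) / (tau - 1) \<le> \<delta> / 2" .
  then show "0 < p1"
    using W_le(1) delta_pos unfolding p1_def by linarith
  have "X1 \<le> (tau - 1) * W"
    using X1_bounds by simp
  also have "\<dots> \<le> (2 * nu / \<delta>) * (3 * \<delta> / 100)"
    unfolding tau_minus_1 using W_le(1) nu_pos delta_pos by (intro mult_left_mono) auto
  also have "\<dots> \<le> nu"
    using delta_pos nu_pos by simp
  finally show "p1 + W \<le> \<delta>"
    using tau1 by (simp add: p1_def)
  have "(tau - 1) * (W2 + W) \<le> (2 * nu / \<delta>) * (8 * \<delta> / 100)"
    unfolding tau_minus_1 using W_le nu_pos delta_pos by (intro mult_left_mono) auto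
  then have "- nu \<le> - ((tau - 1) * (W2 + W))"
    using nu_pos delta_pos by simp
  also have "\<dots> \<le> (1 / tau - 1) * (W2 + W)"
    using mult_right_mono[OF one_minus_inverse_tau_le, of "W2 + W"] W_pos by (simp add: algebra_simps)
  also have "\<dots> \<le> X2 + X3"
    using X2_bounds X3_bounds by (simp add: algebra_simps)
  finally have "0 \<le> Z"
    using nu_pos tau1 tau_pos by (simp add: Z_def)
  then show "\<delta> + W2 \<le> p3"
    by (simp add: p3_def)
  have "Z \<le> (nu + 9 * (tau - 1) / kap) * tau / (tau - 1)"
    unfolding Z_def using X2_le X3_bounds tau1 tau_pos by (intro divide_right_mono mult_right_mono) auto
  also have "\<dots> = nu * tau / (tau - 1) + 9 * tau / kap"
    using tau1 by (simp add: field_simps)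
  also have "nu * tau / (tau - 1) = s - 3 * \<delta> / 2"
    unfolding tau_minus_1 using nu_pos delta_pos by (simp add: tau_def nu_def field_simps)
  also have "9 * tau / kap \<le> 9 * (2 / \<delta>) / kap"
    using tau_le_2_div_delta kap_pos by (intro divide_right_mono mult_left_mono) auto
  also have "9 * (2 / \<delta>) / kap = 18 * \<delta> / 100"
    using delta_pos by (simp add: kap_def power2_eq_square)
  finally show "p3 + W < s"
    using W_le delta_pos by (simp add: p3_def)
qed

lemma smooth_clamp_rise_top: "p + W \<le> x \<Longrightarrow> smooth_clamp L (kap * (x - p)) = L"
  using smooth_clamp_shift_eq_top[of L p x] L_pos by (simp add: W_def)

lemma smooth_clamp_fall_top: "p + W2 \<le> x \<Longrightarrow> smooth_clamp (2 * L) (kap * (x - p)) = 2 * L"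
  using smooth_clamp_shift_eq_top[of "2 * L" p x] L_pos by (simp add: W2_def)

lemma smooth_clamp_rise_0: "x \<le> p \<Longrightarrow> smooth_clamp L (kap * (x - p)) = 0"
  and smooth_clamp_fall_0: "x \<le> p \<Longrightarrow> smooth_clamp (2 * L) (kap * (x - p)) = 0"
  using smooth_clamp_shift_eq_0 L_pos by simp_all

lemma phi_eq_0: "x \<le> p1 \<or> p3 + W \<le> x \<Longrightarrow> phi x = 0"
  using breakpoints_ordered W_pos
  by (auto simp: phi_def smooth_clamp_rise_0 smooth_clamp_fall_0 smooth_clamp_rise_top smooth_clamp_fall_top)

lemma exp_phi_pieces:
  "p1 \<le> x \<Longrightarrow> x \<le> p1 + W \<Longrightarrow> exp (phi x) = rise (x - p1)"
  "p1 + W \<le> x \<Longrightarrow> x \<le> \<delta> \<Longrightarrow> exp (phi x) = tau"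
  "\<delta> \<le> x \<Longrightarrow> x \<le> \<delta> + W2 \<Longrightarrow> exp (phi x) = fall (x - \<delta>)"
  "\<delta> + W2 \<le> x \<Longrightarrow> x \<le> p3 \<Longrightarrow> exp (phi x) = 1 / tau"
  "p3 \<le> x \<Longrightarrow> x \<le> p3 + W \<Longrightarrow> exp (phi x) = rise (x - p3) / tau"
  using breakpoints_ordered W_pos
  by (auto simp: phi_def smooth_clamp_rise_0 smooth_clamp_fall_0 smooth_clamp_rise_top
      smooth_clamp_fall_top rise_def fall_def exp_L exp_minus_L exp_diff)

lemma phi_cases:
  obtains "x \<le> p1" | "p1 \<le> x" "x \<le> p1 + W" | "p1 + W \<le> x" "x \<le> \<delta>"
    | "\<delta> \<le> x" "x \<le> \<delta> + W2" | "\<delta> + W2 \<le> x" "x \<le> p3" | "p3 \<le> x" "x \<le> p3 + W"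
    | "p3 + W \<le> x"
  by (metis linorder_le_cases)

lemma exp_phi_bounds: "1 / tau \<le> exp (phi x) \<and> exp (phi x) \<le> tau"
proof -
  have tau: "1 / tau \<le> 1" "1 \<le> tau"
    using tau_gt_1 by auto
  have rise_div: "1 / tau \<le> rise y / tau \<and> rise y / tau \<le> 1" for y
    using rise_bounds[of y] tau_pos by (simp add: divide_right_mono)
  have rise_wide: "1 / tau \<le> rise y" "rise y / tau \<le> tau" for y
    using rise_div[of y] rise_bounds[of y] tau by linarith+
  show ?thesis
    using rise_bounds fall_bounds rise_div rise_wide tau
    by (cases x rule: phi_cases) (auto simp: exp_phi_pieces phi_eq_0 intro: order_trans)
qed

lemma exp_phi_ge_1: "x \<le> \<delta> \<Longrightarrow> 1 \<le> exp (phi x)"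
  using tau_gt_1 rise_bounds[of "x - p1"] exp_phi_pieces(1,2)[of x] phi_eq_0[of x]
  by (cases "x \<le> p1"; cases "x \<le> p1 + W") auto

lemma exp_phi_le_1: "\<delta> + W2 \<le> x \<Longrightarrow> exp (phi x) \<le> 1"
  using tau_gt_1 rise_bounds[of "x - p3"] tau_pos exp_phi_pieces(4,5)[of x] phi_eq_0[of x]
  by (cases "x \<le> p3"; cases "x \<le> p3 + W") auto

lemma phi_affine_form:
  "phi = (\<lambda>x. smooth_clamp L (kap * x + - kap * p1) - smooth_clamp (2 * L) (kap * x + - kap * \<delta>)
     + smooth_clamp L (kap * x + - kap * p3))"
  by (simp add: phi_def fun_eq_iff algebra_simps)

lemma smooth_fun_phi: "smooth_fun phi"
  unfolding phi_affine_form by (intro smooth_fun_add smooth_fun_diff smooth_fun_smooth_clamp_affine)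

lemma abs_higher_deriv_phi_le: "\<bar>(deriv ^^ Suc i) phi x\<bar> \<le> 6 * step_deriv_bound i * kap ^ Suc i"
proof -
  have bound: "\<bar>(deriv ^^ Suc i) (\<lambda>x. smooth_clamp M (kap * x + b)) x\<bar> \<le> 2 * step_deriv_bound i * kap ^ Suc i"
    for M b
    using abs_higher_deriv_smooth_clamp_affine_le[of i M kap b x] kap_pos by (simp add: mult_ac)
  have "(deriv ^^ Suc i) phi x =
      (deriv ^^ Suc i) (\<lambda>x. smooth_clamp L (kap * x + - kap * p1)) x
      - (deriv ^^ Suc i) (\<lambda>x. smooth_clamp (2 * L) (kap * x + - kap * \<delta>)) x
      + (deriv ^^ Suc i) (\<lambda>x. smooth_clamp L (kap * x + - kap * p3)) x"
    unfolding phi_affine_form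
    by (simp only: higher_deriv_add_real higher_deriv_diff_real smooth_fun_add smooth_fun_diff
        smooth_fun_smooth_clamp_affine)
  then show ?thesis
    using bound[of L "- kap * p1"] bound[of "2 * L" "- kap * \<delta>"] bound[of L "- kap * p3"]
    by linarith
qed

definition phi_periodic :: "real \<Rightarrow> real" where
  "phi_periodic x = phi (s * frac (x / s))"

lemma floor_divide_s_eq_iff: "\<lfloor>z / s\<rfloor> = k \<longleftrightarrow> of_int k * s \<le> z \<and> z < (of_int k + 1) * s"
  using s_pos by (simp add: floor_eq_iff pos_le_divide_eq pos_divide_less_eq)

lemma s_frac_eq: "s * frac (z / s) = z - s * of_int \<lfloor>z / s\<rfloor>"
  using s_pos by (simp add: frac_def algebra_simps)

lemma phi_periodic_eq: "0 \<le> x \<Longrightarrow> x \<le> s \<Longrightarrow> phi_periodic x = phi x"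
proof (cases "x = s")
  case True
  then show ?thesis
    using s_pos breakpoints_ordered phi_eq_0[of 0] phi_eq_0[of s] by (simp add: phi_periodic_def)
next
  case False
  assume "0 \<le> x" "x \<le> s"
  with False have "x / s \<in> {0..<1}"
    using s_pos by (simp add: divide_less_eq)
  then show ?thesis
    using s_pos by (simp add: phi_periodic_def)
qed

lemma phi_periodic_add_period: "phi_periodic (x + s) = phi_periodic x"
  using s_pos by (simp add: phi_periodic_def add_divide_distrib frac_1_eq)

lemma phi_periodic_locally:
  "\<exists>S. open S \<and> x \<in> S \<and> (\<forall>z\<in>S. phi_periodic z = phi (1 * z + - s * of_int \<lfloor>x / s\<rfloor>))"
proof -
  define k where "k = \<lfloor>x / s\<rfloor>"
  define \<eta> where "\<eta> = min p1 (s - (p3 + W))"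
  have \<eta>: "0 < \<eta>" "\<eta> \<le> s"
    using breakpoints_ordered W_pos by (auto simp: \<eta>_def)
  have k: "of_int k * s \<le> x" "x < (of_int k + 1) * s"
    using floor_divide_s_eq_iff[of x k] by (auto simp: k_def)
  define S where "S = {of_int k * s - \<eta> <..< (of_int k + 1) * s}"
  have "phi_periodic z = phi (z - s * of_int k)" if z: "z \<in> S" for z
  proof (cases "of_int k * s \<le> z")
    case True
    then have "\<lfloor>z / s\<rfloor> = k"
      using z floor_divide_s_eq_iff by (auto simp: S_def)
    then show ?thesis
      by (simp add: phi_periodic_def s_frac_eq)
  next
    \<comment> \<open>just left of a multiple of the period both sides vanish\<close>
    case False
    then have "of_int (k - 1) * s \<le> z \<and> z < (of_int (k - 1) + 1) * s"
      using z \<eta> by (auto simp: S_def algebra_simps)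
    then have "\<lfloor>z / s\<rfloor> = k - 1"
      using floor_divide_s_eq_iff by blast
    then have floor_z: "real_of_int \<lfloor>z / s\<rfloor> = real_of_int k - 1"
      by simp
    have "phi_periodic z = phi (z - s * of_int k + s)"
      unfolding phi_periodic_def s_frac_eq floor_z by (simp add: algebra_simps)
    also have "\<dots> = 0"
      using z by (intro phi_eq_0 disjI2) (auto simp: S_def \<eta>_def algebra_simps)
    also have "\<dots> = phi (z - s * of_int k)"
      using False breakpoints_ordered by (intro phi_eq_0[symmetric]) (simp add: algebra_simps)
    finally show ?thesis .
  qed
  moreover have "open S" "x \<in> S"
    using k \<eta> by (auto simp: S_def)
  ultimately show ?thesis
    unfolding k_def by auto
qed

lemma smooth_fun_phi_periodic: "smooth_fun phi_periodic"
proof (rule smooth_fun_local)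
  fix x
  show "\<exists>S h. open S \<and> x \<in> S \<and> smooth_fun h \<and> (\<forall>y\<in>S. phi_periodic y = h y)"
    using phi_periodic_locally[of x] smooth_fun_compose_affine[OF smooth_fun_phi] by blast
qed

lemma abs_higher_deriv_phi_periodic_le:
  "\<bar>(deriv ^^ Suc i) phi_periodic x\<bar> \<le> 6 * step_deriv_bound i * kap ^ Suc i"
proof -
  obtain S where S: "open S" "x \<in> S" "\<forall>z\<in>S. phi_periodic z = phi (1 * z + - s * of_int \<lfloor>x / s\<rfloor>)"
    using phi_periodic_locally by blast
  have "(deriv ^^ Suc i) phi_periodic x = (deriv ^^ Suc i) (\<lambda>z. phi (1 * z + - s * of_int \<lfloor>x / s\<rfloor>)) x"
    using S by (intro higher_deriv_eq_on_open[OF S(1,2)]) blast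
  also have "\<dots> = (deriv ^^ Suc i) phi (x - s * of_int \<lfloor>x / s\<rfloor>)"
    by (simp only: higher_deriv_compose_affine_real[OF smooth_fun_phi]) simp
  finally show ?thesis
    using abs_higher_deriv_phi_le by simp
qed

definition dA :: "real \<Rightarrow> real" where
  "dA x = exp (phi_periodic x)"

definition inv_dA :: "real \<Rightarrow> real" where
  "inv_dA x = exp (- phi_periodic x)"

lemma smooth_fun_dA: "smooth_fun dA"
  unfolding dA_def[abs_def] by (rule smooth_fun_exp[OF smooth_fun_phi_periodic])

lemma continuous_on_dA: "continuous_on UNIV dA"
  by (rule smooth_fun_continuous_on[OF smooth_fun_dA])

lemma smooth_fun_inv_dA: "smooth_fun inv_dA"
  unfolding inv_dA_def[abs_def] by (rule smooth_fun_exp[OF smooth_fun_minus[OF smooth_fun_phi_periodic]])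

lemma inv_dA_mult_dA: "inv_dA x * dA x = 1"
  by (simp add: inv_dA_def dA_def flip: exp_add)

lemma dA_pos: "0 < dA x"
  by (simp add: dA_def)

lemma dA_eq: "0 \<le> x \<Longrightarrow> x \<le> s \<Longrightarrow> dA x = exp (phi x)"
  by (simp add: dA_def phi_periodic_eq)

lemma dA_add_period: "dA (x + s) = dA x"
  by (simp add: dA_def phi_periodic_add_period)

lemma dA_bounds: "1 / tau \<le> dA x \<and> dA x \<le> tau"
  using exp_phi_bounds[of "s * frac (x / s)"] by (simp add: dA_def phi_periodic_def)

lemma inv_dA_le: "inv_dA x \<le> tau"
proof -
  have "inverse (dA x) \<le> inverse (1 / tau)"
    using dA_bounds tau_pos by (intro le_imp_inverse_le) auto
  then show ?thesis
    by (simp add: inv_dA_def dA_def exp_minus)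
qed

definition A :: "real \<Rightarrow> real" where
  "A = antideriv dA"

lemma A_0: "A 0 = 0"
  unfolding A_def by (rule antideriv_0[OF continuous_on_dA])

lemma A_has_real_derivative: "(A has_real_derivative dA x) (at x)"
  unfolding A_def by (rule has_real_derivative_antideriv[OF continuous_on_dA])

lemma A_increment:
  assumes "0 \<le> a" "a \<le> b" "b \<le> s" "\<And>y. y \<in> {a..b} \<Longrightarrow> (G has_real_derivative exp (phi y)) (at y)"
  shows "A b - A a = G b - G a"
  unfolding A_def using assms by (intro antideriv_increment_eq[OF continuous_on_dA]) (auto simp: dA_eq)

lemma A_breakpoints:
  "A p1 = p1"
  "A (p1 + W) - A p1 = antideriv rise W"
  "A \<delta> - A (p1 + W) = tau * (\<delta> - (p1 + W))"
  "A (\<delta> + W2) - A \<delta> = antideriv fall W2"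
  "A p3 - A (\<delta> + W2) = (p3 - (\<delta> + W2)) / tau"
  "A (p3 + W) - A p3 = antideriv rise W / tau"
  "A s - A (p3 + W) = s - (p3 + W)"
proof -
  note ord = breakpoints_ordered W_pos
  note rise' = has_real_derivative_antideriv_shift[OF continuous_on_rise]
  note fall' = has_real_derivative_antideriv_shift[OF continuous_on_fall]
  have "A p1 - A 0 = p1 - 0"
    using ord by (intro A_increment) (auto simp: phi_eq_0)
  then show "A p1 = p1"
    by (simp add: A_0)
  have "A (p1 + W) - A p1 = antideriv rise (p1 + W - p1) - antideriv rise (p1 - p1)"
    using ord rise' by (intro A_increment) (auto simp: exp_phi_pieces)
  then show "A (p1 + W) - A p1 = antideriv rise W"
    by (simp add: antideriv_0[OF continuous_on_rise])
  have "A \<delta> - A (p1 + W) = tau * \<delta> - tau * (p1 + W)"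
    using ord by (intro A_increment) (auto intro!: derivative_eq_intros simp: exp_phi_pieces)
  then show "A \<delta> - A (p1 + W) = tau * (\<delta> - (p1 + W))"
    by (simp add: algebra_simps)
  have "A (\<delta> + W2) - A \<delta> = antideriv fall (\<delta> + W2 - \<delta>) - antideriv fall (\<delta> - \<delta>)"
    using ord fall' by (intro A_increment) (auto simp: exp_phi_pieces)
  then show "A (\<delta> + W2) - A \<delta> = antideriv fall W2"
    by (simp add: antideriv_0[OF continuous_on_fall])
  have "A p3 - A (\<delta> + W2) = p3 / tau - (\<delta> + W2) / tau"
    using ord tau_pos by (intro A_increment) (auto intro!: derivative_eq_intros simp: exp_phi_pieces)
  then show "A p3 - A (\<delta> + W2) = (p3 - (\<delta> + W2)) / tau"
    by (simp add: diff_divide_distrib)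
  have "A (p3 + W) - A p3 = antideriv rise (p3 + W - p3) / tau - antideriv rise (p3 - p3) / tau"
    using ord by (intro A_increment) (auto intro!: DERIV_cdivide rise' simp: exp_phi_pieces)
  then show "A (p3 + W) - A p3 = antideriv rise W / tau"
    by (simp add: antideriv_0[OF continuous_on_rise])
  show "A s - A (p3 + W) = s - (p3 + W)"
    using ord by (intro A_increment) (auto simp: phi_eq_0)
qed

lemma A_delta: "A \<delta> = s - \<delta>"
proof -
  have "(tau - 1) * (\<delta> - (p1 + W)) = nu - X1"
    using tau_gt_1 by (simp add: p1_def)
  then show ?thesis
    using A_breakpoints(1-3) by (simp add: X1_def nu_def algebra_simps)
qed

lemma A_s: "A s = s"
proof -
  have "Z * (1 - 1 / tau) = nu + X2 + X3"
    using tau_gt_1 by (simp add: Z_def field_simps)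
  then show ?thesis
    using A_delta A_breakpoints(4-7)
    by (simp add: X2_def X3_def p3_def nu_def diff_divide_distrib add_divide_distrib algebra_simps)
qed

lemma A_add_period: "A (x + s) = A x + s"
proof -
  have "((\<lambda>x. x + s) has_real_derivative 1) (at y)" for y
    by (auto intro!: derivative_eq_intros)
  then have "((\<lambda>x. A (x + s)) has_real_derivative dA (y + s)) (at y)" for y
    using DERIV_chain2[OF A_has_real_derivative] by fastforce
  then have "((\<lambda>x. A (x + s) - A x) has_real_derivative dA (y + s) - dA y) (at y)" for y
    by (intro DERIV_diff A_has_real_derivative)
  then have "((\<lambda>x. A (x + s) - A x) has_real_derivative 0) (at y)" for y
    by (simp add: dA_add_period)
  then have "\<forall>y. ((\<lambda>x. A (x + s) - A x) has_real_derivative 0) (at y)"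
    by blast
  from DERIV_isconst_all[OF this] have "A (x + s) - A x = A (0 + s) - A 0" .
  then show ?thesis
    by (simp add: A_0 A_s)
qed

lemma A_add_int_period: "A (x + of_int k * s) = A x + of_int k * s"
proof -
  have nat: "A (x + real n * s) = A x + real n * s" for n x
  proof (induction n arbitrary: x)
    case (Suc n)
    have "A (x + real (Suc n) * s) = A ((x + real n * s) + s)"
      by (simp add: algebra_simps)
    also have "\<dots> = A x + real (Suc n) * s"
      by (simp only: A_add_period Suc) (simp add: algebra_simps)
    finally show ?case .
  qed simp
  show ?thesis
  proof (cases "0 \<le> k")
    case True
    then show ?thesis using nat[of x "nat k"] by simp
  next
    case False
    then show ?thesis using nat[of "x + of_int k * s" "nat (- k)"] by simp
  qed
qed

lemma strict_mono_A: "strict_mono A"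
proof (rule strict_monoI)
  fix x y :: real
  assume "x < y"
  then show "A x < A y"
    by (rule DERIV_pos_imp_increasing) (use A_has_real_derivative dA_pos in blast)
qed

lemma A_increment_bounds:
  assumes "a \<le> b" "\<And>y. y \<in> {a..b} \<Longrightarrow> m \<le> dA y \<and> dA y \<le> M"
  shows "m * (b - a) \<le> A b - A a \<and> A b - A a \<le> M * (b - a)"
  unfolding A_def by (rule antideriv_increment_bounds[OF continuous_on_dA assms])

lemma A_ge_on_period:
  assumes x: "0 \<le> x" "x \<le> s"
  shows "x \<le> A x"
proof -
  consider "x \<le> \<delta>" | "\<delta> \<le> x" "x \<le> \<delta> + W2" | "\<delta> + W2 \<le> x"
    by linarith
  then show ?thesis
  proof cases
    case 1
    have "1 \<le> dA y \<and> dA y \<le> tau" if "y \<in> {0..x}" for y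
      using that 1 x two_delta_less dA_bounds[of y] dA_eq[of y] exp_phi_ge_1[of y] by auto
    then have "1 * (x - 0) \<le> A x - A 0"
      using A_increment_bounds[of 0 x 1 tau] x by blast
    then show ?thesis
      by (simp add: A_0)
  next
    case 2
    then have "(x - \<delta>) / tau \<le> A x - A \<delta>"
      using A_increment_bounds[of \<delta> x "1 / tau" tau] dA_bounds by auto
    moreover have "(x - \<delta>) * (1 - 1 / tau) \<le> W2 * (tau - 1)"
      using 2 tau_gt_1 one_minus_inverse_tau_le by (intro mult_mono) auto
    moreover have "W2 * (tau - 1) \<le> (5 * \<delta> / 100) * (2 * nu / \<delta>)"
      unfolding tau_minus_1 using W_le nu_pos delta_pos by (intro mult_right_mono) auto
    moreover have "(x - \<delta>) / tau = (x - \<delta>) - (x - \<delta>) * (1 - 1 / tau)"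
      by (simp add: algebra_simps)
    ultimately show ?thesis
      using A_delta nu_pos delta_pos by (simp add: nu_def)
  next
    case 3
    have "1 / tau \<le> dA y \<and> dA y \<le> 1" if "y \<in> {x..s}" for y
      using that 3 x dA_bounds[of y] dA_eq[of y] exp_phi_le_1[of y] by auto
    then have "A s - A x \<le> 1 * (s - x)"
      using A_increment_bounds[of x s "1 / tau" 1] x by blast
    then show ?thesis
      by (simp add: A_s)
  qed
qed

lemma A_ge: "x \<le> A x"
proof -
  define y where "y = s * frac (x / s)"
  have "x = y + of_int \<lfloor>x / s\<rfloor> * s"
    by (simp add: y_def s_frac_eq)
  moreover have "y \<le> A y"
    using s_pos frac_lt_1[of "x / s"] by (intro A_ge_on_period) (auto simp: y_def)
  ultimately show ?thesis
    using A_add_int_period[of y "\<lfloor>x / s\<rfloor>"] by simp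
qed

lemma surj_A: "surj A"
proof -
  have "\<exists>x. A x = y" for y
  proof -
    define k where "k = \<lfloor>y / s\<rfloor>"
    have "A (of_int k * s) = of_int k * s" "A ((of_int k + 1) * s) = (of_int k + 1) * s"
      using A_add_int_period[of 0 k] A_add_int_period[of 0 "k + 1"] by (simp_all add: A_0)
    then have "A (of_int k * s) \<le> y" "y \<le> A ((of_int k + 1) * s)" "of_int k * s \<le> (of_int k + 1) * s"
      using floor_divide_s_eq_iff[of y k] s_pos by (auto simp: k_def)
    then show ?thesis
      using IVT[of A "of_int k * s" y "(of_int k + 1) * s"] DERIV_isCont[OF A_has_real_derivative]
      by blast
  qed
  then show ?thesis
    by (metis surjI)
qed

definition Ainv :: "real \<Rightarrow> real" where
  "Ainv = inv A"

lemma A_Ainv: "A (Ainv y) = y" and Ainv_A: "Ainv (A x) = x"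
  unfolding Ainv_def using surj_A strict_mono_A by (auto simp: surj_f_inv_f strict_mono_imp_inj_on)

lemma smooth_fun_A: "smooth_fun A"
  unfolding A_def by (rule smooth_fun_antideriv[OF smooth_fun_dA])

lemma deriv_A: "deriv A = dA"
  by (rule deriv_eqI[OF A_has_real_derivative])

lemma higher_deriv_Ainv: "(deriv ^^ Suc n) Ainv = (\<lambda>y. inverse_deriv_aux inv_dA n (Ainv y))"
  and smooth_fun_Ainv: "smooth_fun Ainv"
  using higher_deriv_inverse_function[OF A_has_real_derivative dA_pos smooth_fun_inv_dA inv_dA_mult_dA Ainv_A A_Ainv]
  by auto

lemma abs_higher_deriv_dA_le: "\<bar>(deriv ^^ j) dA x\<bar> \<le> slope_deriv_const j * kap ^ j * dA x"
  unfolding dA_def[abs_def] slope_deriv_const_def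
  by (rule abs_higher_deriv_exp_le[OF smooth_fun_phi_periodic less_imp_le[OF kap_pos]
        abs_higher_deriv_phi_periodic_le])

lemma abs_higher_deriv_inv_dA_le: "\<bar>(deriv ^^ j) inv_dA x\<bar> \<le> slope_deriv_const j * kap ^ j * inv_dA x"
  unfolding inv_dA_def[abs_def] slope_deriv_const_def
  by (rule abs_higher_deriv_exp_le[OF smooth_fun_minus[OF smooth_fun_phi_periodic] less_imp_le[OF kap_pos]])
     (simp only: higher_deriv_minus_real[OF smooth_fun_phi_periodic] abs_minus_cancel
        abs_higher_deriv_phi_periodic_le)

lemma kap_power: "kap ^ n = 100 ^ n / \<delta> ^ (2 * n)"
  by (simp add: kap_def power_divide power_mult)

lemma abs_higher_deriv_A_le:
  "\<bar>(deriv ^^ Suc m) A x\<bar> \<le> 2 * 100 ^ m * slope_deriv_const m / \<delta> ^ (2 * m + 1)"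
proof -
  have "(deriv ^^ Suc m) A = (deriv ^^ m) dA"
    by (simp only: higher_deriv_Suc_inner deriv_A)
  then have "\<bar>(deriv ^^ Suc m) A x\<bar> \<le> slope_deriv_const m * kap ^ m * dA x"
    using abs_higher_deriv_dA_le by simp
  also have "\<dots> \<le> slope_deriv_const m * kap ^ m * (2 / \<delta>)"
    using dA_bounds[of x] tau_le_2_div_delta kap_pos slope_deriv_const_nonneg by (intro mult_left_mono) auto
  also have "\<dots> = 2 * 100 ^ m * slope_deriv_const m / \<delta> ^ (2 * m + 1)"
    using delta_pos by (simp add: kap_power field_simps)
  finally show ?thesis .
qed

lemma abs_higher_deriv_Ainv_le:
  "\<bar>(deriv ^^ Suc m) Ainv y\<bar>
     \<le> 2 ^ Suc m * 100 ^ m * inverse_deriv_const slope_deriv_const m 0 / \<delta> ^ (3 * m + 1)"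
proof -
  have "\<bar>(deriv ^^ Suc m) Ainv y\<bar> = \<bar>inverse_deriv_aux inv_dA m (Ainv y)\<bar>"
    by (simp only: higher_deriv_Ainv)
  also have "\<dots> \<le> inverse_deriv_const slope_deriv_const m 0 * kap ^ m * inv_dA (Ainv y) ^ Suc m"
    using abs_higher_deriv_inverse_deriv_aux_le[OF smooth_fun_inv_dA abs_higher_deriv_inv_dA_le, of 0 m "Ainv y"]
    by simp
  also have "\<dots> \<le> inverse_deriv_const slope_deriv_const m 0 * kap ^ m * (2 / \<delta>) ^ Suc m"
    using order.trans[OF inv_dA_le tau_le_2_div_delta] kap_pos
      inverse_deriv_const_nonneg[OF slope_deriv_const_nonneg]
    by (intro mult_left_mono power_mono) (auto simp: inv_dA_def)
  also have "\<dots> = 2 ^ Suc m * 100 ^ m * inverse_deriv_const slope_deriv_const m 0 / \<delta> ^ (3 * m + 1)"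
    using delta_pos by (simp add: kap_power power_divide field_simps flip: power_add)
  finally show ?thesis .
qed

lemma divide_delta_power_mono:
  assumes "0 \<le> c" "c \<le> r" "e \<le> e'"
  shows "c / \<delta> ^ e \<le> r / \<delta> ^ e'"
proof -
  have "\<delta> ^ e' \<le> \<delta> ^ e"
    using assms(3) delta_pos delta_le_1 by (intro power_decreasing) auto
  then have "c / \<delta> ^ e \<le> c / \<delta> ^ e'"
    using assms(1) delta_pos by (intro divide_left_mono) auto
  also have "\<dots> \<le> r / \<delta> ^ e'"
    using assms(2) delta_pos by (intro divide_right_mono) auto
  finally show ?thesis .
qed

lemma A_mem_unit_iff:
  assumes "real k * s = 1"
  shows "A x \<in> {0..1} \<longleftrightarrow> x \<in> {0..1}"
proof -
  have "A 1 = 1"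
    using A_add_int_period[of 0 "int k"] assms by (simp add: A_0)
  then show ?thesis
    using strict_mono_less_eq[OF strict_mono_A, of 0 x] strict_mono_less_eq[OF strict_mono_A, of x 1] A_0
    by simp
qed

lemma Ainv_mem_unit: "real k * s = 1 \<Longrightarrow> y \<in> {0..1} \<Longrightarrow> Ainv y \<in> {0..1}"
  using A_mem_unit_iff[of k "Ainv y"] by (simp add: A_Ainv)

lemma diffeo01_A_Ainv: "real k * s = 1 \<Longrightarrow> diffeo01 A Ainv"
  unfolding diffeo01_def
  using smooth_fun_A smooth_fun_Ainv A_mem_unit_iff Ainv_mem_unit by (simp add: A_Ainv Ainv_A)

lemma cn_norm_A_Ainv_le:
  assumes "real k * s = 1"
  shows "cn_norm n A Ainv \<le> norm_const n / \<delta> ^ n\<^sup>2"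
proof -
  have "\<bar>(deriv ^^ i) g x\<bar> \<le> norm_const n / \<delta> ^ n\<^sup>2"
    if g: "g = A \<or> g = Ainv" and i: "i \<le> n" and x: "x \<in> {0..1}" for g i x
  proof (cases i)
    case 0
    have "g x \<in> {0..1}"
      using g x A_mem_unit_iff[OF assms] Ainv_mem_unit[OF assms] by auto
    then have "\<bar>g x\<bar> \<le> 1 / \<delta> ^ 0"
      by simp
    also have "\<dots> \<le> norm_const n / \<delta> ^ n\<^sup>2"
      using norm_const_ge(1) by (intro divide_delta_power_mono) auto
    finally show ?thesis
      using 0 by simp
  next
    case (Suc m)
    then have "m + (m + m * m) < n\<^sup>2"
      using i mult_le_mono[of "Suc m" n "Suc m" n] unfolding power2_eq_square by simp
    then have exponents: "2 * m + 1 \<le> n\<^sup>2" "3 * m + 1 \<le> n\<^sup>2"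
      using le_square[of m] by linarith+
    have "m < n"
      using Suc i by simp
    have "\<bar>(deriv ^^ Suc m) A x\<bar> \<le> 2 * 100 ^ m * slope_deriv_const m / \<delta> ^ (2 * m + 1)"
      by (rule abs_higher_deriv_A_le)
    also have "\<dots> \<le> norm_const n / \<delta> ^ n\<^sup>2"
      by (rule divide_delta_power_mono)
         (use slope_deriv_const_nonneg[of m] norm_const_ge(2)[OF \<open>m < n\<close>] exponents in auto)
    moreover have "\<bar>(deriv ^^ Suc m) Ainv x\<bar>
        \<le> 2 ^ Suc m * 100 ^ m * inverse_deriv_const slope_deriv_const m 0 / \<delta> ^ (3 * m + 1)"
      by (rule abs_higher_deriv_Ainv_le)
    moreover have "\<dots> \<le> norm_const n / \<delta> ^ n\<^sup>2"
      by (rule divide_delta_power_mono)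
         (use inverse_deriv_const_nonneg[of slope_deriv_const, OF slope_deriv_const_nonneg]
            norm_const_ge(3)[OF \<open>m < n\<close>] exponents in auto)
    ultimately have "\<bar>(deriv ^^ i) A x\<bar> \<le> norm_const n / \<delta> ^ n\<^sup>2"
      "\<bar>(deriv ^^ i) Ainv x\<bar> \<le> norm_const n / \<delta> ^ n\<^sup>2"
      unfolding Suc by linarith+
    with g show ?thesis
      by blast
  qed
  then have "cn_star n A \<le> norm_const n / \<delta> ^ n\<^sup>2" "cn_star n Ainv \<le> norm_const n / \<delta> ^ n\<^sup>2"
    by (intro cn_star_le; blast)+
  then show ?thesis
    by (simp add: cn_norm_def)
qed

end

lemma exists_push_diffeo:
  assumes "0 < s" "0 < \<delta>" "1 / s = real k" "\<delta> < s / 2"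
  shows "\<exists>A Ainv a :: real \<Rightarrow> real.
       diffeo01 A Ainv \<and>
       A = (\<lambda>x. x + a x) \<and> smooth_fun a \<and> (\<forall>x. a x \<ge> 0) \<and> (\<forall>x. a (x + s) = a x) \<and>
       A 0 = 0 \<and> A \<delta> = s - \<delta> \<and> A s = s \<and>
       (\<forall>x. \<delta> / (2 * s) \<le> deriv A x \<and> deriv A x \<le> 2 * s / \<delta>) \<and>
       (\<forall>n. cn_norm n A Ainv \<le> norm_const n / \<delta> ^ (n\<^sup>2))"
proof -
  have k: "real k * s = 1"
    using assms(1,3) by (simp add: field_simps)
  then have "1 \<le> real k"
    by (cases k) auto
  then have "s \<le> 1"
    using k assms(1) mult_right_mono[of 1 "real k" s] by simp
  then interpret push_construction s \<delta>
    using assms by unfold_locales auto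
  show ?thesis
  proof (rule exI[of _ A], rule exI[of _ Ainv], rule exI[of _ "\<lambda>x. A x - x"], intro conjI allI)
    show "diffeo01 A Ainv"
      by (rule diffeo01_A_Ainv[OF k])
    show "cn_norm n A Ainv \<le> norm_const n / \<delta> ^ n\<^sup>2" for n
      by (rule cn_norm_A_Ainv_le[OF k])
    show "A = (\<lambda>x. x + (A x - x))" "A 0 = 0" "A \<delta> = s - \<delta>" "A s = s"
      by (simp_all add: A_0 A_delta A_s)
    show "smooth_fun (\<lambda>x. A x - x)"
      by (intro smooth_fun_diff smooth_fun_A smooth_fun_ident)
    show "0 \<le> A x - x" "A (x + s) - (x + s) = A x - x" for x
      using A_ge A_add_period by simp_all
    show "\<delta> / (2 * s) \<le> deriv A x" "deriv A x \<le> 2 * s / \<delta>" for x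
      using dA_bounds[of x] delta_div_2s_le_inverse_tau tau_le by (auto simp: deriv_A)
  qed
qed

theorem lemma3p3:
  shows "\<exists>\<rho> :: nat \<Rightarrow> real. \<forall>s \<delta> :: real.
    s > 0 \<and> \<delta> > 0 \<and> (\<exists>k::nat. 1 / s = real k) \<and> \<delta> < s / 2 \<longrightarrow>
    (\<exists>A Ainv a :: real \<Rightarrow> real.
       diffeo01 A Ainv \<and>
       A = (\<lambda>x. x + a x) \<and> smooth_fun a \<and> (\<forall>x. a x \<ge> 0) \<and> (\<forall>x. a (x + s) = a x) \<and>
       A 0 = 0 \<and> A \<delta> = s - \<delta> \<and> A s = s \<and>
       (\<forall>x. \<delta> / (2 * s) \<le> deriv A x \<and> deriv A x \<le> 2 * s / \<delta>) \<and>
       (\<forall>n. cn_norm n A Ainv \<le> \<rho> n / \<delta> ^ (n\<^sup>2)))"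
  by (intro exI[of _ norm_const] allI impI) (blast intro: exists_push_diffeo)

end
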